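(* Let $R>1$ and $\mu\in(0,1/2]$. There is a constant $C>0$ (depending only on $R$ and $\mu$) such that the following holds. Let $H$ be a sufficiently smooth function on $[0,\infty)\times\mathbb R^2$ with $\operatorname{supp}H(t,\cdot)\subset\{x:|x|\le R\}$ for every $t\ge0$, and let $v$ be the solution of the Cauchy problem $$\Box v=H(t,x),\quad (t,x)\in[0,\infty)\times\mathbb R^2,\qquad (v,\partial_tv)(0,x)=(0,0),\quad x\in\mathbb R^2 .$$ Then for all $(t,x)\in[0,\infty)\times\mathbb R^2$, $$\langle t+|x|\rangle^{1/2}\langle t-|x|\rangle^{\mu}|v(t,x)|\le C\,\big(\ln(2+t+|x|)\big)^2\sup_{(s,y)\in[0,t]\times\mathbb R^2}\langle s\rangle^{1/2+\mu}|(1-\Delta)H(s,y)|.$$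
   Context: $\Box=\partial_t^2-\Delta$ with $\Delta=\partial_{x_1}^2+\partial_{x_2}^2$ on $\mathbb R^2$; $\langle y\rangle=\sqrt{1+|y|^2}$. *)

theory Defs
  imports "HOL-Analysis.Analysis"
begin

definition japanese :: "'a::real_normed_vector \<Rightarrow> real"  ("\<langle>_\<rangle>") where
  "\<langle>y\<rangle> = sqrt (1 + (norm y)\<^sup>2)"

text \<open>Spacetime \<open>[0,\<infinity>) \<times> \<real>\<^sup>2\<close>, closed at \<open>t = 0\<close>.\<close>

definition spacetime :: "(real \<times> (real^2)) set" where
  "spacetime = {0..} \<times> UNIV"

text \<open>\<open>Ck_on k S f\<close>: \<open>f\<close> is of class \<open>C\<^sup>k\<close> on \<open>S\<close>. Derivatives are taken within \<open>S\<close>, so for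
  \<open>S = spacetime\<close> they are one-sided in time on the boundary \<open>t = 0\<close>, and all derivatives up to
  order \<open>k\<close> are continuous up to that boundary. In finite dimension, continuity of
  \<open>p \<mapsto> f' p\<close> is the same as continuity of \<open>p \<mapsto> f' p h\<close> for every direction \<open>h\<close>; recursing on
  the directional derivatives keeps the type of \<open>f\<close> fixed.\<close>

primrec Ck_on ::
  "nat \<Rightarrow> 'a::euclidean_space set \<Rightarrow> ('a \<Rightarrow> 'b::real_normed_vector) \<Rightarrow> bool" where
  "Ck_on 0 S f \<longleftrightarrow> continuous_on S f"
| "Ck_on (Suc k) S f \<longleftrightarrow>
     (\<exists>f'. (\<forall>p\<in>S. (f has_derivative f' p) (at p within S)) \<and> (\<forall>h. Ck_on k S (\<lambda>p. f' p h)))"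

definition partial :: "2 \<Rightarrow> (real^2 \<Rightarrow> real) \<Rightarrow> real^2 \<Rightarrow> real" where
  "partial i u x = deriv (\<lambda>h. u (x + h *\<^sub>R axis i 1)) 0"

definition laplacian :: "(real^2 \<Rightarrow> real) \<Rightarrow> real^2 \<Rightarrow> real" where
  "laplacian u x = partial 1 (partial 1 u) x + partial 2 (partial 2 u) x"

text \<open>The time derivative is one-sided at \<open>t = 0\<close>.\<close>

definition time_deriv :: "(real \<Rightarrow> real^2 \<Rightarrow> real) \<Rightarrow> real \<Rightarrow> real^2 \<Rightarrow> real" where
  "time_deriv u t x = vector_derivative (\<lambda>s. u s x) (at t within {0..})"

definition dalembertian :: "(real \<Rightarrow> real^2 \<Rightarrow> real) \<Rightarrow> real \<Rightarrow> real^2 \<Rightarrow> real" where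
  "dalembertian u t x = time_deriv (time_deriv u) t x - laplacian (u t) x"

text \<open>Classical solution of the Cauchy problem with source \<open>H\<close> and zero data. For \<open>H\<close> of
  class \<open>C\<^sup>2\<close> there is exactly one on \<open>spacetime\<close>.\<close>

definition solves_wave ::
  "(real \<Rightarrow> real^2 \<Rightarrow> real) \<Rightarrow> (real \<Rightarrow> real^2 \<Rightarrow> real) \<Rightarrow> bool" where
  "solves_wave H v \<longleftrightarrow>
     Ck_on 2 spacetime (\<lambda>(t, x). v t x) \<and>
     (\<forall>t\<ge>0. \<forall>x. dalembertian v t x = H t x) \<and>
     (\<forall>x. v 0 x = 0 \<and> time_deriv v 0 x = 0)"

end

theory Submission
  imports Defs
begin

text \<open>
  Regard a function on \<open>\<real>\<^sup>2\<close> as a function on \<open>\<real>\<^sup>3\<close> that does not depend on the third variable.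
  Kirchhoff's formula then expresses a solution \<open>u(t, x)\<close> by integrals over the upper unit hemisphere,
  whose points are \<open>(sin \<phi> dir \<theta>, cos \<phi>)\<close>: the mean over the hemisphere of
  \<open>\<tau> \<partial>\<^sub>t u + u + \<tau> sin \<phi> dir \<theta> \<bullet> \<nabla>u\<close> at \<open>(s, x + \<tau> sin \<phi> dir \<theta>)\<close>, \<open>\<tau> = t - s\<close>,
  equals \<open>u(t, x)\<close> at \<open>s = t\<close> and has \<open>s\<close>-derivative \<open>\<tau>\<close> times the mean of \<open>\<box>u\<close>.
  No convolution kernel has to be integrated: the means of the source are dominated by those of
  \<open>(1 + |y|\<^sup>2)\<^bsup>-3/2\<^esup>\<close>, which is the initial velocity of the explicit solution
  \<open>- Im (|x|\<^sup>2 + (1 + \<i>t)\<^sup>2)\<^bsup>-1/2\<^esup>\<close> with vanishing initial value. Its modulus is at most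
  \<open>(\<langle>t + |x|\<rangle>\<langle>t - |x|\<rangle>)\<^bsup>-1/2\<^esup>\<close>, so a one-dimensional integral in \<open>s\<close> remains. The source itself is
  bounded by \<open>sup |(1 - \<Delta>)H|\<close> through the maximum principle.
\<close>

section \<open>Functions with two continuous derivatives\<close>

text \<open>\<open>D2 h p k\<close> differentiates first along \<open>h\<close>, then along
  \<open>k\<close>. Fixing both derivatives as arguments makes them nameable in later formulas;
  their symmetry is proved separately.\<close>

definition jet2 ::
  "'a::euclidean_space set \<Rightarrow> ('a \<Rightarrow> real) \<Rightarrow> ('a \<Rightarrow> 'a \<Rightarrow> real) \<Rightarrow> ('a \<Rightarrow> 'a \<Rightarrow> 'a \<Rightarrow> real) \<Rightarrow> bool" where
  "jet2 S u D D2 \<longleftrightarrow>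
     (\<forall>p\<in>S. (u has_derivative D p) (at p within S)) \<and>
     (\<forall>h. \<forall>p\<in>S. ((\<lambda>p. D p h) has_derivative D2 h p) (at p within S)) \<and>
     (\<forall>h k. continuous_on S (\<lambda>p. D2 h p k))"

lemma Ck_on_2_imp_jet2:
  assumes "Ck_on 2 S u"
  obtains D D2 where "jet2 S u D D2"
proof -
  obtain D where D: "\<And>p. p \<in> S \<Longrightarrow> (u has_derivative D p) (at p within S)"
    and "\<And>h. Ck_on (Suc 0) S (\<lambda>p. D p h)"
    using assms by (auto simp: numeral_2_eq_2)
  then have "\<forall>h. \<exists>B. (\<forall>p\<in>S. ((\<lambda>p. D p h) has_derivative B p) (at p within S)) \<and>
      (\<forall>k. continuous_on S (\<lambda>p. B p k))"
    by simp
  then obtain D2 where "\<And>h. (\<forall>p\<in>S. ((\<lambda>p. D p h) has_derivative D2 h p) (at p within S)) \<and>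
      (\<forall>k. continuous_on S (\<lambda>p. D2 h p k))"
    by metis
  with D that show thesis
    unfolding jet2_def by blast
qed

lemma jet2_D:
  assumes "jet2 S u D D2"
  shows jet2_deriv: "p \<in> S \<Longrightarrow> (u has_derivative D p) (at p within S)"
    and jet2_deriv2: "p \<in> S \<Longrightarrow> ((\<lambda>p. D p h) has_derivative D2 h p) (at p within S)"
    and jet2_cont2: "continuous_on S (\<lambda>p. D2 h p k)"
    and jet2_cont1: "continuous_on S (\<lambda>p. D p h)"
    and jet2_cont0: "continuous_on S u"
    and jet2_linear: "p \<in> S \<Longrightarrow> linear (D p)"
    and jet2_linear2: "p \<in> S \<Longrightarrow> linear (D2 h p)"
  using assms unfolding jet2_def
  by (blast intro: has_derivative_continuous_on has_derivative_linear)+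

text \<open>The curve need only stay in \<open>S\<close>, so it may touch the boundary
  \<open>t = 0\<close>, where the derivatives are one-sided.\<close>

lemma jet2_path:
  assumes "jet2 S u D D2" and "f ` T \<subseteq> S" and "s \<in> T"
    and "(f has_vector_derivative d) (at s within T)"
  shows "((\<lambda>s. u (f s)) has_real_derivative D (f s) d) (at s within T)"
    and "((\<lambda>s. D (f s) h) has_real_derivative D2 h (f s) d) (at s within T)"
proof -
  have f: "(f has_derivative (\<lambda>x. x *\<^sub>R d)) (at s within T)"
    using assms(4) by (simp add: has_vector_derivative_def)
  have "f s \<in> S" using assms by auto
  note lin = jet2_linear[OF assms(1) this] jet2_linear2[OF assms(1) this]
  show "((\<lambda>s. u (f s)) has_real_derivative D (f s) d) (at s within T)"
    using has_derivative_in_compose2[OF jet2_deriv[OF assms(1)] assms(2,3) f]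
    by (simp add: has_field_derivative_def linear_cmul[OF lin(1)] mult.commute[of _ "D (f s) d"])
  show "((\<lambda>s. D (f s) h) has_real_derivative D2 h (f s) d) (at s within T)"
    using has_derivative_in_compose2[OF jet2_deriv2[OF assms(1), where h=h] assms(2,3) f]
    by (simp add: has_field_derivative_def linear_cmul[OF lin(2)] mult.commute[of _ "D2 h (f s) d"])
qed

section \<open>Symmetry of second derivatives within a set\<close>

lemma mvt_within:
  fixes f :: "real \<Rightarrow> real"
  assumes "a \<le> b" and "\<And>x. x \<in> {a..b} \<Longrightarrow> (f has_real_derivative f' x) (at x within {a..b})"
  obtains x where "x \<in> {a..b}" "f b - f a = (b - a) * f' x"
proof -
  have "\<exists>x\<in>{a..b}. f b - f a = f' x * (b - a)"
    using assms by (intro mvt_very_simple) (auto simp: has_field_derivative_def)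
  with that show thesis by (auto simp: mult.commute)
qed

text \<open>Two uses of the mean value theorem: along \<open>h\<close> for the difference of
  \<open>u\<close> between the sides shifted by \<open>a *\<^sub>R k\<close> and unshifted, then
  along \<open>k\<close> for the resulting difference of first derivatives.\<close>

lemma jet2_second_difference:
  assumes jet: "jet2 S u D D2" and "a > 0"
    and S: "\<And>\<alpha> \<beta>. \<alpha> \<in> {0..a} \<Longrightarrow> \<beta> \<in> {0..a} \<Longrightarrow> p + \<alpha> *\<^sub>R h + \<beta> *\<^sub>R k \<in> S"
  shows "\<exists>\<alpha>\<in>{0..a}. \<exists>\<beta>\<in>{0..a}.
    u (p + a *\<^sub>R h + a *\<^sub>R k) - u (p + a *\<^sub>R h) - u (p + a *\<^sub>R k) + u p
      = a * (a * D2 h (p + \<alpha> *\<^sub>R h + \<beta> *\<^sub>R k) k)"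
proof -
  have der: "((\<lambda>\<alpha>. u (p + \<alpha> *\<^sub>R h + \<beta> *\<^sub>R k)) has_real_derivative
      D (p + \<alpha> *\<^sub>R h + \<beta> *\<^sub>R k) h) (at \<alpha> within {0..a})"
    if "\<alpha> \<in> {0..a}" "\<beta> \<in> {0..a}" for \<alpha> \<beta>
    by (rule jet2_path(1)[OF jet _ that(1)])
       (use S that in \<open>auto intro!: derivative_eq_intros\<close>)
  obtain \<alpha> where "\<alpha> \<in> {0..a}"
    "(u (p + a *\<^sub>R h + a *\<^sub>R k) - u (p + a *\<^sub>R h + 0 *\<^sub>R k)) -
      (u (p + 0 *\<^sub>R h + a *\<^sub>R k) - u (p + 0 *\<^sub>R h + 0 *\<^sub>R k))
      = (a - 0) * (D (p + \<alpha> *\<^sub>R h + a *\<^sub>R k) h - D (p + \<alpha> *\<^sub>R h + 0 *\<^sub>R k) h)"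
    using mvt_within[OF _ DERIV_diff[OF der[of _ a] der[of _ 0]]] \<open>a > 0\<close>
    by (smt (verit) atLeastAtMost_iff)
  then have \<alpha>: "\<alpha> \<in> {0..a}"
    "u (p + a *\<^sub>R h + a *\<^sub>R k) - u (p + a *\<^sub>R h) - u (p + a *\<^sub>R k) + u p
      = a * (D (p + \<alpha> *\<^sub>R h + a *\<^sub>R k) h - D (p + \<alpha> *\<^sub>R h) h)"
    by auto
  have der2: "((\<lambda>\<beta>. D (p + \<alpha> *\<^sub>R h + \<beta> *\<^sub>R k) h) has_real_derivative
      D2 h (p + \<alpha> *\<^sub>R h + \<beta> *\<^sub>R k) k) (at \<beta> within {0..a})"
    if "\<beta> \<in> {0..a}" for \<beta>
    by (rule jet2_path(2)[OF jet _ that(1)])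
       (use S that \<alpha> in \<open>auto intro!: derivative_eq_intros\<close>)
  obtain \<beta> where "\<beta> \<in> {0..a}"
    "D (p + \<alpha> *\<^sub>R h + a *\<^sub>R k) h - D (p + \<alpha> *\<^sub>R h + 0 *\<^sub>R k) h
      = (a - 0) * D2 h (p + \<alpha> *\<^sub>R h + \<beta> *\<^sub>R k) k"
    using mvt_within[OF _ der2] \<open>a > 0\<close> by (smt (verit))
  with \<alpha> show ?thesis
    by (intro bexI[of _ \<alpha>] bexI[of _ \<beta>]) auto
qed

text \<open>Schwarz's theorem: the second difference is symmetric in \<open>h\<close> and
  \<open>k\<close>, so its two mean value forms agree on parallelograms shrinking to
  \<open>p\<close>, and continuity passes to the limit. Only a one-sided parallelogram at
  \<open>p\<close> has to lie in \<open>S\<close>, which admits points with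
  \<open>t = 0\<close>.\<close>

lemma jet2_symmetric:
  assumes jet: "jet2 S u D D2" and "r > 0"
    and S: "\<And>\<alpha> \<beta>. \<alpha> \<in> {0..r} \<Longrightarrow> \<beta> \<in> {0..r} \<Longrightarrow> p + \<alpha> *\<^sub>R h + \<beta> *\<^sub>R k \<in> S"
  shows "D2 h p k = D2 k p h"
proof -
  define a where "a n = r / Suc n" for n
  have a: "a n > 0" "a n \<le> r" for n
    using \<open>r > 0\<close> by (auto simp: a_def field_simps)
  have a0: "a \<longlonglongrightarrow> 0"
    unfolding a_def using LIMSEQ_inverse_real_of_nat[THEN tendsto_mult_right_zero, of r]
    by (simp add: divide_inverse)
  have pS: "p \<in> S" using S[of 0 0] \<open>r > 0\<close> by simp
  have "\<exists>\<alpha> \<beta> \<alpha>' \<beta>'. \<alpha> \<in> {0..a n} \<and> \<beta> \<in> {0..a n} \<and> \<alpha>' \<in> {0..a n} \<and> \<beta>' \<in> {0..a n} \<and>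
      D2 h (p + \<alpha> *\<^sub>R h + \<beta> *\<^sub>R k) k = D2 k (p + \<alpha>' *\<^sub>R h + \<beta>' *\<^sub>R k) h" for n
  proof -
    obtain \<alpha> \<beta> where 1: "\<alpha> \<in> {0..a n}" "\<beta> \<in> {0..a n}"
      "u (p + a n *\<^sub>R h + a n *\<^sub>R k) - u (p + a n *\<^sub>R h) - u (p + a n *\<^sub>R k) + u p
        = a n * (a n * D2 h (p + \<alpha> *\<^sub>R h + \<beta> *\<^sub>R k) k)"
      using jet2_second_difference[OF jet a(1)[of n], of p h k] S a(2)[of n] by force
    obtain \<beta>' \<alpha>' where 2: "\<alpha>' \<in> {0..a n}" "\<beta>' \<in> {0..a n}"
      "u (p + a n *\<^sub>R k + a n *\<^sub>R h) - u (p + a n *\<^sub>R k) - u (p + a n *\<^sub>R h) + u p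
        = a n * (a n * D2 k (p + \<beta>' *\<^sub>R k + \<alpha>' *\<^sub>R h) h)"
      using jet2_second_difference[OF jet a(1)[of n], of p k h] S a(2)[of n]
      by (force simp: algebra_simps)
    from 1(3) 2(3) have "D2 h (p + \<alpha> *\<^sub>R h + \<beta> *\<^sub>R k) k = D2 k (p + \<alpha>' *\<^sub>R h + \<beta>' *\<^sub>R k) h"
      using a(1)[of n] by (simp add: algebra_simps)
    with 1 2 show ?thesis by blast
  qed
  then obtain \<alpha> \<beta> \<alpha>' \<beta>' where b: "\<And>n. \<alpha> n \<in> {0..a n}" "\<And>n. \<beta> n \<in> {0..a n}"
      "\<And>n. \<alpha>' n \<in> {0..a n}" "\<And>n. \<beta>' n \<in> {0..a n}"
    and eq: "\<And>n. D2 h (p + \<alpha> n *\<^sub>R h + \<beta> n *\<^sub>R k) k = D2 k (p + \<alpha>' n *\<^sub>R h + \<beta>' n *\<^sub>R k) h"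
    by metis
  have lim: "(\<lambda>n. D2 h' (p + x n *\<^sub>R h + y n *\<^sub>R k) k') \<longlonglongrightarrow> D2 h' p k'"
    if x: "\<And>n. x n \<in> {0..a n}" and y: "\<And>n. y n \<in> {0..a n}" for x y h' k'
  proof -
    have x0: "x \<longlonglongrightarrow> 0" "y \<longlonglongrightarrow> 0"
      by (rule tendsto_sandwich[OF _ _ tendsto_const a0]; use x y in force)+
    have p: "(\<lambda>n. p + x n *\<^sub>R h + y n *\<^sub>R k) \<longlonglongrightarrow> p"
      by (rule tendsto_eq_intros x0 refl | simp)+
    have "p + x n *\<^sub>R h + y n *\<^sub>R k \<in> S" for n
      using x[of n] y[of n] a(2)[of n] by (intro S) auto
    then show ?thesis
      by (intro continuous_on_tendsto_compose[OF jet2_cont2[OF jet] p pS]) auto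
  qed
  from lim[OF b(1,2), of h k] lim[OF b(3,4), of k h] show ?thesis
    unfolding eq by (rule LIMSEQ_unique)
qed

section \<open>Kirchhoff means\<close>

definition dir :: "real \<Rightarrow> real^2" where
  "dir \<theta> = cos \<theta> *\<^sub>R axis 1 1 + sin \<theta> *\<^sub>R axis 2 1"

text \<open>The backward light cone with tip \<open>(t, x, 0)\<close> in three space dimensions, in
  polar angle \<phi> and azimuth \<theta>, with the third space coordinate forgotten.\<close>

definition cone_pt :: "real \<Rightarrow> real^2 \<Rightarrow> real \<Rightarrow> real \<Rightarrow> real \<Rightarrow> real \<times> (real^2)" where
  "cone_pt t x s \<phi> \<theta> = (s, x + ((t - s) * sin \<phi>) *\<^sub>R dir \<theta>)"

abbreviation hemi :: "(real \<times> real) set" where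
  "hemi \<equiv> cbox (0, 0) (pi / 2, 2 * pi)"

definition wave_op :: "(real \<times> (real^2) \<Rightarrow> real \<times> (real^2) \<Rightarrow> real \<times> (real^2) \<Rightarrow> real) \<Rightarrow> real \<times> (real^2) \<Rightarrow> real" where
  "wave_op D2 p = D2 (1, 0) p (1, 0) - D2 (0, axis 1 1) p (0, axis 1 1) - D2 (0, axis 2 1) p (0, axis 2 1)"

text \<open>The outer \<open>sin \<phi>\<close> is the density of the surface measure. The mean is
  not normalized, so the hemisphere area 2 pi appears in all identities below.\<close>

definition kirchhoff ::
  "(real \<times> (real^2) \<Rightarrow> real) \<Rightarrow> (real \<times> (real^2) \<Rightarrow> real \<times> (real^2) \<Rightarrow> real) \<Rightarrow>
    real \<Rightarrow> real^2 \<Rightarrow> real \<Rightarrow> real \<times> real \<Rightarrow> real" where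
  "kirchhoff u D t x s = (\<lambda>(\<phi>, \<theta>). let p = cone_pt t x s \<phi> \<theta> in
     sin \<phi> * ((t - s) * D p (1, 0) + u p
       + (t - s) * sin \<phi> * (cos \<theta> * D p (0, axis 1 1) + sin \<theta> * D p (0, axis 2 1))))"

text \<open>This and the next lemma discard exact derivatives: in \<phi> because the primitive
  vanishes at both ends, in \<theta> by periodicity.\<close>

lemma integral_rect_deriv_fst:
  fixes P :: "real \<Rightarrow> real \<Rightarrow> real"
  assumes "a \<le> b" "\<And>x y. x \<in> {a..b} \<Longrightarrow> y \<in> {c..d} \<Longrightarrow> ((\<lambda>x. P x y) has_real_derivative P' x y) (at x within {a..b})"
    and "continuous_on (cbox (a, c) (b, d)) (\<lambda>(x, y). P' x y)"
    and "\<And>y. y \<in> {c..d} \<Longrightarrow> P a y = P b y"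
  shows "integral (cbox (a, c) (b, d)) (\<lambda>(x, y). P' x y) = 0"
proof -
  have "integral {a..b} (\<lambda>x. P' x y) = 0" if "y \<in> {c..d}" for y
    using fundamental_theorem_of_calculus[of a b "\<lambda>x. P x y" "\<lambda>x. P' x y"] assms that
    by (auto simp: has_real_derivative_iff_has_vector_derivative integral_unique)
  then have "integral {c..d} (\<lambda>y. integral {a..b} (\<lambda>x. P' x y)) = integral {c..d} (\<lambda>_. 0)"
    by (intro integral_cong) auto
  then show ?thesis
    using integral_prod_continuous[OF assms(3)] integral_swap_continuous[OF assms(3)] by simp
qed

lemma integral_rect_deriv_snd:
  fixes P :: "real \<Rightarrow> real \<Rightarrow> real"
  assumes "c \<le> d" "\<And>x y. x \<in> {a..b} \<Longrightarrow> y \<in> {c..d} \<Longrightarrow> ((\<lambda>y. P x y) has_real_derivative P' x y) (at y within {c..d})"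
    and "continuous_on (cbox (a, c) (b, d)) (\<lambda>(x, y). P' x y)"
    and "\<And>x. x \<in> {a..b} \<Longrightarrow> P x c = P x d"
  shows "integral (cbox (a, c) (b, d)) (\<lambda>(x, y). P' x y) = 0"
proof -
  have "integral {c..d} (\<lambda>y. P' x y) = 0" if "x \<in> {a..b}" for x
    using fundamental_theorem_of_calculus[of c d "\<lambda>y. P x y" "\<lambda>y. P' x y"] assms that
    by (auto simp: has_real_derivative_iff_has_vector_derivative integral_unique)
  then have "integral {a..b} (\<lambda>x. integral {c..d} (\<lambda>y. P' x y)) = integral {a..b} (\<lambda>_. 0)"
    by (intro integral_cong) auto
  then show ?thesis
    using integral_prod_continuous[OF assms(3)] by simp
qed

text \<open>
  The left-hand side is \<open>\<partial>\<^sub>s\<close> of the integrand of \<open>kirchhoff\<close>, with \<open>S, C = sin \<phi>, cos \<phi>\<close>,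
  \<open>s, c = sin \<theta>, cos \<theta>\<close> and \<open>u0, U01, \<dots>\<close> the derivatives of \<open>u\<close>. On the right, besides the wave
  operator, stand \<open>\<partial>\<^sub>\<phi>(S C (c u1 + s u2))\<close> and \<open>\<partial>\<^sub>\<theta>(c u2 - s u1)\<close>, which integrate to zero: this is
  the vanishing integral of the spherical Laplacian, written without a singularity at the pole.
\<close>

lemma kirchhoff_algebra:
  fixes S C s c \<tau> :: real
  assumes "C\<^sup>2 = 1 - S\<^sup>2" "c\<^sup>2 = 1 - s\<^sup>2"
  shows "S * (- u0 + \<tau> * (U00 - S * c * U01 - S * s * U02)
      + (u0 - S * c * u1 - S * s * u2) - S * (c * u1 + s * u2)
      + \<tau> * S * (c * (U01 - S * c * U11 - S * s * U12) + s * (U02 - S * c * U21 - S * s * U22)))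
    = \<tau> * (S * (U00 - U11 - U22))
      + ((C\<^sup>2 - S\<^sup>2) * (c * u1 + s * u2)
        + S * C * (c * (\<tau> * C * (c * U11 + s * U12)) + s * (\<tau> * C * (c * U21 + s * U22))))
      + (- c * u1 - s * u2 - s * (\<tau> * S * (c * U12 - s * U11)) + c * (\<tau> * S * (c * U22 - s * U21)))"
  using assms by algebra

section \<open>Differentiation of Kirchhoff means along the backward cone\<close>

lemma linear_spacetime:
  fixes L :: "real \<times> (real^2) \<Rightarrow> real"
  assumes "linear L"
  shows "L (a *\<^sub>R (1, 0) + b *\<^sub>R (0, axis 1 1) + c *\<^sub>R (0, axis 2 1))
    = a * L (1, 0) + b * L (0, axis 1 1) + c * L (0, axis 2 1)"
  by (simp only: linear_add[OF assms] linear_cmul[OF assms] real_scaleR_def)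

lemma cone_pt_vector_derivative:
  shows "((\<lambda>s. cone_pt t x s \<phi> \<theta>) has_vector_derivative
      1 *\<^sub>R (1, 0) + (- sin \<phi> * cos \<theta>) *\<^sub>R (0, axis 1 1) + (- sin \<phi> * sin \<theta>) *\<^sub>R (0, axis 2 1)) (at s within T)"
    and "((\<lambda>\<phi>. cone_pt t x s \<phi> \<theta>) has_vector_derivative
      0 *\<^sub>R (1, 0) + ((t - s) * cos \<phi> * cos \<theta>) *\<^sub>R (0, axis 1 1)
        + ((t - s) * cos \<phi> * sin \<theta>) *\<^sub>R (0, axis 2 1)) (at \<phi> within T)"
    and "((\<lambda>\<theta>. cone_pt t x s \<phi> \<theta>) has_vector_derivative
      0 *\<^sub>R (1, 0) + ((t - s) * sin \<phi> * (- sin \<theta>)) *\<^sub>R (0, axis 1 1)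
        + ((t - s) * sin \<phi> * cos \<theta>) *\<^sub>R (0, axis 2 1)) (at \<theta> within T)"
  unfolding cone_pt_def dir_def
  by (auto intro!: derivative_eq_intros simp: zero_prod_def algebra_simps
       simp flip: has_real_derivative_iff_has_vector_derivative)

lemma continuous_on_cone_pt [continuous_intros]:
  fixes s \<phi> \<theta> :: "'a::t2_space \<Rightarrow> real"
  assumes "continuous_on A s" "continuous_on A \<phi>" "continuous_on A \<theta>"
  shows "continuous_on A (\<lambda>z. cone_pt t x (s z) (\<phi> z) (\<theta> z))"
  unfolding cone_pt_def dir_def
  by (intro continuous_intros assms)

lemma cone_pt_in_spacetime [simp]: "cone_pt t x s \<phi> \<theta> \<in> spacetime \<longleftrightarrow> 0 \<le> s"
  by (simp add: cone_pt_def spacetime_def)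

context
  fixes u :: "real \<times> (real^2) \<Rightarrow> real" and D D2 and t :: real and x :: "real^2"
  assumes jet: "jet2 spacetime u D D2" and t: "0 \<le> t"
begin

lemma kirchhoff_at_tip: "integral hemi (kirchhoff u D t x t) = 2 * pi * u (t, x)"
proof -
  have "integral {0..pi/2} sin = - cos (pi/2) - - cos 0"
    by (intro integral_unique fundamental_theorem_of_calculus)
       (auto intro!: derivative_eq_intros simp flip: has_real_derivative_iff_has_vector_derivative)
  then have sin: "integral {0..pi/2} sin = (1::real)" by simp
  have "integral hemi (kirchhoff u D t x t) = integral hemi (\<lambda>(\<phi>, \<theta>). sin \<phi> * u (t, x))"
    by (simp add: kirchhoff_def cone_pt_def Let_def)
  also have "\<dots> = integral {0..pi/2} (\<lambda>\<phi>. integral {0..2*pi} (\<lambda>\<theta>. sin \<phi> * u (t, x)))"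
    by (subst integral_prod_continuous)
       (auto intro!: continuous_intros simp: case_prod_beta)
  also have "\<dots> = integral {0..pi/2} (\<lambda>\<phi>. sin \<phi> * (2 * pi * u (t, x)))"
    by (simp add: mult_ac)
  also have "\<dots> = 2 * pi * u (t, x)"
    by (simp add: sin)
  finally show ?thesis .
qed

lemma continuous_on_kirchhoff:
  fixes A :: "'b::t2_space set"
  assumes "continuous_on A s" "continuous_on A z" "\<And>y. y \<in> A \<Longrightarrow> 0 \<le> s y"
  shows "continuous_on A (\<lambda>y. kirchhoff u D t x (s y) (z y))"
  unfolding kirchhoff_def case_prod_beta Let_def
  by (intro continuous_intros assms
      continuous_on_compose2[OF jet2_cont0[OF jet]] continuous_on_compose2[OF jet2_cont1[OF jet]])
     (use assms(3) in auto)

text \<open>Differentiation under the integral sign, followed by \<open>kirchhoff_algebra\<close>: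
  the integrand becomes \<open>(t - s) * N\<close> plus an exact \<phi>-derivative \<open>P\<close>
  and an exact \<theta>-derivative \<open>Q\<close>.\<close>

lemma kirchhoff_has_derivative:
  assumes s: "s \<in> {0..t}"
  shows "((\<lambda>s. integral hemi (kirchhoff u D t x s)) has_real_derivative
    (t - s) * integral hemi (\<lambda>(\<phi>, \<theta>). sin \<phi> * wave_op D2 (cone_pt t x s \<phi> \<theta>))) (at s within {0..t})"
proof -
  let ?e = "(1, 0) :: real \<times> (real^2)"
  let ?e1 = "(0, axis 1 1) :: real \<times> (real^2)"
  let ?e2 = "(0, axis 2 1) :: real \<times> (real^2)"
  let ?X = "\<lambda>s \<phi> \<theta>. cone_pt t x s \<phi> \<theta>"
  define N where "N s \<phi> \<theta> = sin \<phi> * wave_op D2 (?X s \<phi> \<theta>)" for s \<phi> \<theta>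
  define P where "P s \<phi> \<theta> = (let p = ?X s \<phi> \<theta>; \<tau> = t - s in
      ((cos \<phi>)\<^sup>2 - (sin \<phi>)\<^sup>2) * (cos \<theta> * D p ?e1 + sin \<theta> * D p ?e2)
        + sin \<phi> * cos \<phi> * (cos \<theta> * (\<tau> * cos \<phi> * (cos \<theta> * D2 ?e1 p ?e1 + sin \<theta> * D2 ?e1 p ?e2))
          + sin \<theta> * (\<tau> * cos \<phi> * (cos \<theta> * D2 ?e2 p ?e1 + sin \<theta> * D2 ?e2 p ?e2))))" for s \<phi> \<theta>
  define Q where "Q s \<phi> \<theta> = (let p = ?X s \<phi> \<theta>; \<tau> = t - s in
      - cos \<theta> * D p ?e1 - sin \<theta> * D p ?e2
        - sin \<theta> * (\<tau> * sin \<phi> * (cos \<theta> * D2 ?e1 p ?e2 - sin \<theta> * D2 ?e1 p ?e1))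
        + cos \<theta> * (\<tau> * sin \<phi> * (cos \<theta> * D2 ?e2 p ?e2 - sin \<theta> * D2 ?e2 p ?e1)))" for s \<phi> \<theta>
  have cD: "continuous_on A (\<lambda>y. D (?X (s y) (\<phi> y) (\<theta> y)) h)"
      "continuous_on A (\<lambda>y. D2 h (?X (s y) (\<phi> y) (\<theta> y)) k)"
    if "continuous_on A s" "continuous_on A \<phi>" "continuous_on A \<theta>" "\<And>y. y \<in> A \<Longrightarrow> 0 \<le> s y"
    for A :: "'b::t2_space set" and s \<phi> \<theta> h k
    by (intro continuous_intros that
      continuous_on_compose2[OF jet2_cont1[OF jet]] continuous_on_compose2[OF jet2_cont2[OF jet]];
      use that(4) in auto)+
  have cN: "continuous_on A (\<lambda>y. N (s y) (\<phi> y) (\<theta> y))"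
    and cP: "continuous_on A (\<lambda>y. P (s y) (\<phi> y) (\<theta> y))"
    and cQ: "continuous_on A (\<lambda>y. Q (s y) (\<phi> y) (\<theta> y))"
    if "continuous_on A s" "continuous_on A \<phi>" "continuous_on A \<theta>" "\<And>y. y \<in> A \<Longrightarrow> 0 \<le> s y"
    for A :: "'b::t2_space set" and s \<phi> \<theta>
    unfolding N_def P_def Q_def wave_op_def Let_def
    by (intro continuous_intros that cD; use that(4) in auto)+
  have im: "(\<lambda>s. ?X s \<phi> \<theta>) ` {0..t} \<subseteq> spacetime" "s \<ge> 0 \<Longrightarrow> ?X s \<phi> \<theta> \<in> spacetime"
    "s \<ge> 0 \<Longrightarrow> (\<lambda>\<phi>. ?X s \<phi> \<theta>) ` T \<subseteq> spacetime" "s \<ge> 0 \<Longrightarrow> (\<lambda>\<theta>. ?X s \<phi> \<theta>) ` T \<subseteq> spacetime"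
    for s \<phi> \<theta> T
    by auto
  note lin = linear_spacetime[OF jet2_linear[OF jet im(2)]] linear_spacetime[OF jet2_linear2[OF jet im(2)]]
  have dK: "((\<lambda>s. kirchhoff u D t x s z) has_real_derivative
      (t - s) * N s (fst z) (snd z) + P s (fst z) (snd z) + Q s (fst z) (snd z)) (at s within {0..t})"
    if s: "s \<in> {0..t}" for s z
  proof -
    obtain \<phi> \<theta> where z: "z = (\<phi>, \<theta>)" by fastforce
    have "s \<ge> 0" using s by simp
    define p where "p = ?X s \<phi> \<theta>"
    \<comment> \<open>The \<open>s\<close>-derivative yields mixed time-space derivatives in both
      orders, which have to be identified. The two mixed space derivatives are kept apart in
      \<open>kirchhoff_algebra\<close>.\<close>
    have sym: "D2 ?e1 p ?e = D2 ?e p ?e1" "D2 ?e2 p ?e = D2 ?e p ?e2"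
      unfolding p_def
      by (rule jet2_symmetric[OF jet zero_less_one]; use \<open>s \<ge> 0\<close> in \<open>simp add: cone_pt_def spacetime_def\<close>)+
    note dX = jet2_path[OF jet im(1)[of \<phi> \<theta>] s cone_pt_vector_derivative(1),
        unfolded lin[OF \<open>s \<ge> 0\<close>], folded p_def]
    let ?C = "cos \<phi>" and ?S = "sin \<phi>" and ?c = "cos \<theta>" and ?s = "sin \<theta>"
    have "((\<lambda>s. kirchhoff u D t x s z) has_real_derivative
      ?S * (- D p ?e + (t - s) * (D2 ?e p ?e - ?S * ?c * D2 ?e p ?e1 - ?S * ?s * D2 ?e p ?e2)
      + (D p ?e - ?S * ?c * D p ?e1 - ?S * ?s * D p ?e2) - ?S * (?c * D p ?e1 + ?s * D p ?e2)
      + (t - s) * ?S * (?c * (D2 ?e p ?e1 - ?S * ?c * D2 ?e1 p ?e1 - ?S * ?s * D2 ?e1 p ?e2)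
          + ?s * (D2 ?e p ?e2 - ?S * ?c * D2 ?e2 p ?e1 - ?S * ?s * D2 ?e2 p ?e2)))) (at s within {0..t})"
      unfolding kirchhoff_def z Let_def prod.case
      by (rule derivative_eq_intros dX refl)+ (simp add: sym algebra_simps flip: p_def)
    also have "?S * (- D p ?e + (t - s) * (D2 ?e p ?e - ?S * ?c * D2 ?e p ?e1 - ?S * ?s * D2 ?e p ?e2)
      + (D p ?e - ?S * ?c * D p ?e1 - ?S * ?s * D p ?e2) - ?S * (?c * D p ?e1 + ?s * D p ?e2)
      + (t - s) * ?S * (?c * (D2 ?e p ?e1 - ?S * ?c * D2 ?e1 p ?e1 - ?S * ?s * D2 ?e1 p ?e2)
          + ?s * (D2 ?e p ?e2 - ?S * ?c * D2 ?e2 p ?e1 - ?S * ?s * D2 ?e2 p ?e2)))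
      = (t - s) * N s \<phi> \<theta> + P s \<phi> \<theta> + Q s \<phi> \<theta>"
      unfolding N_def P_def Q_def Let_def wave_op_def p_def[symmetric]
      by (rule kirchhoff_algebra) (auto simp: cos_squared_eq)
    finally show ?thesis by (simp add: z)
  qed
  have cP': "continuous_on hemi (\<lambda>(\<phi>, \<theta>). P s \<phi> \<theta>)" and cQ': "continuous_on hemi (\<lambda>(\<phi>, \<theta>). Q s \<phi> \<theta>)"
    and cN': "continuous_on hemi (\<lambda>(\<phi>, \<theta>). N s \<phi> \<theta>)"
    unfolding case_prod_beta using s by (intro cP cQ cN continuous_intros; simp)+
  \<comment> \<open>The primitive of \<open>P\<close> vanishes at the pole through
    \<open>sin \<phi>\<close> and at the equator through \<open>cos \<phi>\<close>; that of
    \<open>Q\<close> below is periodic in \<theta>.\<close>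
  have dP: "((\<lambda>\<phi>. sin \<phi> * cos \<phi> * (cos \<theta> * D (?X s \<phi> \<theta>) ?e1 + sin \<theta> * D (?X s \<phi> \<theta>) ?e2))
      has_real_derivative P s \<phi> \<theta>) (at \<phi> within {0..pi/2})" if "\<phi> \<in> {0..pi/2}" for \<phi> \<theta>
  proof -
    have "s \<ge> 0" using s by simp
    note dX = jet2_path(2)[OF jet im(3)[OF \<open>s \<ge> 0\<close>] that cone_pt_vector_derivative(2), unfolded lin[OF \<open>s \<ge> 0\<close>]]
    show ?thesis
      unfolding P_def Let_def
      by (rule derivative_eq_intros dX refl)+ (simp add: power2_eq_square algebra_simps)
  qed
  have dQ: "((\<lambda>\<theta>. - sin \<theta> * D (?X s \<phi> \<theta>) ?e1 + cos \<theta> * D (?X s \<phi> \<theta>) ?e2)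
      has_real_derivative Q s \<phi> \<theta>) (at \<theta> within {0..2*pi})" if "\<theta> \<in> {0..2*pi}" for \<phi> \<theta>
  proof -
    have "s \<ge> 0" using s by simp
    note dX = jet2_path(2)[OF jet im(4)[OF \<open>s \<ge> 0\<close>] that cone_pt_vector_derivative(3), unfolded lin[OF \<open>s \<ge> 0\<close>]]
    show ?thesis
      unfolding Q_def Let_def
      by (rule derivative_eq_intros dX refl)+ (simp add: algebra_simps)
  qed
  have "integral hemi (\<lambda>(\<phi>, \<theta>). P s \<phi> \<theta>) = 0"
    by (rule integral_rect_deriv_fst[OF _ dP cP']) auto
  moreover have "integral hemi (\<lambda>(\<phi>, \<theta>). Q s \<phi> \<theta>) = 0"
    by (rule integral_rect_deriv_snd[OF _ dQ cQ']) (auto simp: cone_pt_def dir_def)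
  moreover have "((\<lambda>s. integral hemi (kirchhoff u D t x s)) has_real_derivative
    integral hemi (\<lambda>z. (t - s) * N s (fst z) (snd z) + P s (fst z) (snd z) + Q s (fst z) (snd z))) (at s within {0..t})"
    unfolding has_real_derivative_iff_has_vector_derivative
  proof (rule leibniz_rule_vector_derivative[OF _ _ _ s])
    show "((\<lambda>s. kirchhoff u D t x s z) has_vector_derivative
       ((t - s) * N s (fst z) (snd z) + P s (fst z) (snd z) + Q s (fst z) (snd z))) (at s within {0..t})"
      if "s \<in> {0..t}" for s z
      using dK[OF that] by (simp add: has_real_derivative_iff_has_vector_derivative)
    show "kirchhoff u D t x s integrable_on hemi" if "s \<in> {0..t}" for s
      by (rule integrable_continuous, rule continuous_on_kirchhoff) (use that in \<open>auto intro: continuous_intros\<close>)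
    show "continuous_on ({0..t} \<times> hemi) (\<lambda>(s, z). (t - s) * N s (fst z) (snd z) + P s (fst z) (snd z) + Q s (fst z) (snd z))"
      unfolding case_prod_beta
      by (intro continuous_intros cN cP cQ) auto
  qed auto
  moreover have "integral hemi (\<lambda>z. (t - s) * N s (fst z) (snd z) + P s (fst z) (snd z) + Q s (fst z) (snd z))
      = (t - s) * integral hemi (\<lambda>(\<phi>, \<theta>). N s \<phi> \<theta>) + integral hemi (\<lambda>(\<phi>, \<theta>). P s \<phi> \<theta>)
        + integral hemi (\<lambda>(\<phi>, \<theta>). Q s \<phi> \<theta>)"
    unfolding case_prod_beta
    using cN'[unfolded case_prod_beta, THEN integrable_continuous]
      cP'[unfolded case_prod_beta, THEN integrable_continuous]
      cQ'[unfolded case_prod_beta, THEN integrable_continuous]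
    by (simp add: integral_add integrable_add integrable_on_mult_right)
  ultimately show ?thesis
    by (simp add: N_def)
qed

end

section \<open>A complex-shifted fundamental solution\<close>

text \<open>
  \<open>csq (t, x) = |x|\<^sup>2 + (1 + \<i>t)\<^sup>2\<close> is the Euclidean distance squared in \<open>\<real>\<^sup>3\<close> with complexified third
  coordinate \<open>1 + \<i>t\<close>; harmonicity of the Newton potential turns into the wave equation for
  \<open>csq powr (- 1/2)\<close>.
\<close>

definition csq :: "real \<times> (real^2) \<Rightarrow> complex" where
  "csq p = of_real (snd p \<bullet> snd p) + (1 + \<i> * of_real (fst p))\<^sup>2"

text \<open>Half the derivative of \<open>csq\<close>; the missing 2 cancels against the exponent
  -1/2 in the kernel.\<close>

definition csq_deriv :: "real \<times> (real^2) \<Rightarrow> real \<times> (real^2) \<Rightarrow> complex" where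
  "csq_deriv p h = of_real (snd p \<bullet> snd h) + \<i> * (1 + \<i> * of_real (fst p)) * of_real (fst h)"

text \<open>The imaginary part is \<open>2 * t\<close>, and at \<open>t = 0\<close> the value is
  \<open>1 + |x|^2 > 0\<close>. Hence the principal branch of every power is smooth
  everywhere.\<close>

lemma csq_not_nonpos: "csq p \<notin> \<real>\<^sub>\<le>\<^sub>0"
proof
  assume "csq p \<in> \<real>\<^sub>\<le>\<^sub>0"
  then have 0: "Im (csq p) = 0" "Re (csq p) \<le> 0"
    by (auto simp: complex_nonpos_Reals_iff)
  then have "fst p = 0"
    by (simp add: csq_def power2_eq_square)
  with 0(2) have "snd p \<bullet> snd p + 1 \<le> 0"
    by (simp add: csq_def power2_eq_square)
  then show False
    using inner_ge_zero[of "snd p"] by linarith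
qed

lemma csq_nonzero [simp]: "csq p \<noteq> 0"
  using csq_not_nonpos[of p] by auto

text \<open>With \<open>r = |x|\<close>, \<open>csq\<close> factors as
  \<open>(r - t + i) * (r + t - i)\<close>, whose moduli are the two brackets. This is the source of
  the decay weights.\<close>

lemma norm_csq: "norm (csq (t, x)) = \<langle>t + norm x\<rangle> * \<langle>t - norm x\<rangle>"
proof -
  have "norm (csq (t, x)) = sqrt (((norm x)\<^sup>2 + 1 - t\<^sup>2)\<^sup>2 + (2 * t)\<^sup>2)"
    by (simp add: cmod_def csq_def power2_eq_square power2_norm_eq_inner[symmetric, unfolded power2_eq_square] algebra_simps)
  also have "((norm x)\<^sup>2 + 1 - t\<^sup>2)\<^sup>2 + (2 * t)\<^sup>2 = (1 + (t + norm x)\<^sup>2) * (1 + (t - norm x)\<^sup>2)"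
    by algebra
  finally show ?thesis
    by (simp add: japanese_def real_sqrt_mult)
qed

lemma csq_has_derivative: "(csq has_derivative (\<lambda>h. 2 * csq_deriv p h)) (at p within S)"
  unfolding csq_def csq_deriv_def
  by (auto intro!: derivative_eq_intros simp: inner_commute algebra_simps power2_eq_square)

lemma csq_deriv_has_derivative:
  "((\<lambda>p. csq_deriv p h) has_derivative (\<lambda>k. of_real (snd h \<bullet> snd k - fst h * fst k))) (at p within S)"
  unfolding csq_deriv_def
  by (auto intro!: derivative_eq_intros simp: inner_commute algebra_simps)

lemma csq_powr_has_derivative:
  "((\<lambda>p. csq p powr a) has_derivative (\<lambda>h. 2 * a * csq p powr (a - 1) * csq_deriv p h)) (at p within S)"
proof -
  have "((\<lambda>z. z powr a) has_derivative (*) (a * csq p powr (a - 1))) (at (csq p))"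
    using has_field_derivative_powr[OF csq_not_nonpos, of a p] by (simp add: has_field_derivative_def)
  from has_derivative_compose[OF csq_has_derivative this] show ?thesis
    by (simp add: mult_ac)
qed

text \<open>The sign makes the initial velocity positive, as needed for a majorant.\<close>

definition wave_kernel :: "real \<times> (real^2) \<Rightarrow> real" where
  "wave_kernel p = - Im (csq p powr (- 1/2))"

definition wave_kernel_D :: "real \<times> (real^2) \<Rightarrow> real \<times> (real^2) \<Rightarrow> real" where
  "wave_kernel_D p h = Im (csq p powr (- 3/2) * csq_deriv p h)"

definition wave_kernel_D2 :: "real \<times> (real^2) \<Rightarrow> real \<times> (real^2) \<Rightarrow> real \<times> (real^2) \<Rightarrow> real" where
  "wave_kernel_D2 h p k = Im (csq p powr (- 3/2) * of_real (snd h \<bullet> snd k - fst h * fst k)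
     - 3 * csq p powr (- 5/2) * csq_deriv p h * csq_deriv p k)"

lemma jet2_kernel: "jet2 S wave_kernel wave_kernel_D wave_kernel_D2"
  unfolding jet2_def
proof (intro conjI allI ballI)
  fix p h
  have "((\<lambda>p. - Im (csq p powr (- 1/2))) has_derivative
      (\<lambda>h. - Im (2 * (- 1/2) * csq p powr (- 1/2 - 1) * csq_deriv p h))) (at p within S)"
    by (intro has_derivative_minus has_derivative_Im csq_powr_has_derivative)
  then show "(wave_kernel has_derivative wave_kernel_D p) (at p within S)"
    by (simp add: wave_kernel_def[abs_def] wave_kernel_D_def[abs_def] add.commute)
  have "((\<lambda>p. Im (csq p powr (- 3/2) * csq_deriv p h)) has_derivative
      (\<lambda>k. Im (csq p powr (- 3/2) * of_real (snd h \<bullet> snd k - fst h * fst k)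
        + 2 * (- 3/2) * csq p powr (- 3/2 - 1) * csq_deriv p k * csq_deriv p h))) (at p within S)"
    by (intro has_derivative_Im has_derivative_mult csq_powr_has_derivative csq_deriv_has_derivative)
  then show "((\<lambda>p. wave_kernel_D p h) has_derivative wave_kernel_D2 h p) (at p within S)"
    by (simp add: wave_kernel_D_def[abs_def] wave_kernel_D2_def[abs_def] algebra_simps)
next
  fix h k
  have 1: "continuous_on S (\<lambda>p. csq p powr a)" for a
    using csq_powr_has_derivative by (rule has_derivative_continuous_on)
  have 2: "continuous_on S (\<lambda>p. csq_deriv p h)" for h
    using csq_deriv_has_derivative by (rule has_derivative_continuous_on)
  show "continuous_on S (\<lambda>p. wave_kernel_D2 h p k)"
    unfolding wave_kernel_D2_def
    by (intro continuous_on_Im continuous_on_diff continuous_on_mult continuous_on_const 1 2)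
qed

text \<open>The factors \<open>of_real (snd h \<bullet> snd k - fst h * fst k)\<close> contribute -3
  in total, and the signed squares of \<open>csq_deriv\<close> add up to \<open>- csq p\<close>. The
  two powers of \<open>csq\<close> then cancel.\<close>

lemma wave_op_kernel: "wave_op wave_kernel_D2 p = 0"
proof -
  have "csq p powr (- 3/2) = csq p powr (- 5/2) * csq p powr 1"
    unfolding powr_add[symmetric] by simp
  then have 1: "csq p powr (- 3/2) = csq p powr (- 5/2) * csq p"
    by simp
  have "snd p \<bullet> snd p = (snd p $ 1)\<^sup>2 + (snd p $ 2)\<^sup>2"
    by (simp add: inner_vec_def sum_2 power2_eq_square)
  then have 2: "csq p = of_real ((snd p $ 1)\<^sup>2 + (snd p $ 2)\<^sup>2) + (1 + \<i> * of_real (fst p))\<^sup>2"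
    by (simp add: csq_def)
  have "wave_op wave_kernel_D2 p = Im (- 3 * csq p powr (- 3/2)
      + 3 * csq p powr (- 5/2) * (of_real ((snd p $ 1)\<^sup>2 + (snd p $ 2)\<^sup>2) + (1 + \<i> * of_real (fst p))\<^sup>2))"
    unfolding wave_op_def wave_kernel_D2_def minus_complex.sel(2)[symmetric]
    by (intro arg_cong[of _ _ Im])
      (simp add: csq_deriv_def inner_axis inner_axis_axis power2_eq_square algebra_simps)
  also have "\<dots> = 0"
    unfolding 2[symmetric] 1 by simp
  finally show ?thesis .
qed

lemma csq_powr_initial: "csq (0, x) powr of_real a = of_real ((1 + x \<bullet> x) powr a)"
proof -
  have "csq (0, x) = of_real (1 + x \<bullet> x)"
    by (simp add: csq_def)
  then show ?thesis
    by (simp add: powr_of_real del: of_real_add)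
qed

text \<open>At \<open>t = 0\<close> all powers of \<open>csq\<close> are real, so imaginary parts
  vanish, except in the time derivative, where \<open>csq_deriv\<close> equals the imaginary
  unit.\<close>

lemma wave_kernel_initial:
  shows "wave_kernel (0, x) = 0" "wave_kernel_D (0, x) (0, h) = 0"
    and "wave_kernel_D (0, x) (1, 0) = (1 + x \<bullet> x) powr (- 3/2)"
  using csq_powr_initial[of x "- 1/2"] csq_powr_initial[of x "- 3/2"]
  by (simp_all add: wave_kernel_def wave_kernel_D_def csq_deriv_def)

lemma abs_wave_kernel_le: "\<bar>wave_kernel (t, x)\<bar> \<le> \<langle>t + norm x\<rangle> powr (- 1/2) * \<langle>t - norm x\<rangle> powr (- 1/2)"
proof -
  have "\<bar>wave_kernel (t, x)\<bar> \<le> norm (csq (t, x) powr (- 1/2))"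
    using abs_Im_le_cmod by (simp add: wave_kernel_def)
  also have "\<dots> = norm (csq (t, x)) powr (- 1/2)"
    by (subst norm_powr_real_powr') auto
  finally show ?thesis
    by (simp add: norm_csq powr_mult japanese_def)
qed

text \<open>Kirchhoff's formula read backwards: for a solution of the homogeneous equation the mean
  is constant in \<open>s\<close>. At \<open>s = 0\<close> it is the left-hand side, at
  \<open>s = t\<close> it is 2 pi times the explicit kernel.\<close>

lemma wave_kernel_mean_bound:
  assumes t: "0 \<le> t"
  shows "t * integral hemi (\<lambda>(\<phi>, \<theta>). let y = x + (t * sin \<phi>) *\<^sub>R dir \<theta> in sin \<phi> * (1 + y \<bullet> y) powr (- 3/2))
    \<le> 2 * pi * (\<langle>t + norm x\<rangle> powr (- 1/2) * \<langle>t - norm x\<rangle> powr (- 1/2))"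
proof -
  let ?g = "\<lambda>s. integral hemi (kirchhoff wave_kernel wave_kernel_D t x s)"
  have "(?g has_field_derivative 0) (at s within {0..t})" if "s \<in> {0..t}" for s
    using kirchhoff_has_derivative[OF jet2_kernel t that, of x] by (simp add: wave_op_kernel case_prod_unfold)
  then obtain c where "\<And>s. s \<in> {0..t} \<Longrightarrow> ?g s = c"
    using has_field_derivative_zero_constant[of "{0..t}" ?g] by auto
  then have "?g 0 = ?g t"
    using t by auto
  also have "\<dots> = 2 * pi * wave_kernel (t, x)"
    by (rule kirchhoff_at_tip[OF jet2_kernel t])
  also have "\<dots> \<le> 2 * pi * (\<langle>t + norm x\<rangle> powr (- 1/2) * \<langle>t - norm x\<rangle> powr (- 1/2))"
    using abs_wave_kernel_le[of t x] by (intro mult_left_mono) auto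
  finally have "?g 0 \<le> \<dots>" .
  also have "kirchhoff wave_kernel wave_kernel_D t x 0 = (\<lambda>z. t * (case z of (\<phi>, \<theta>) \<Rightarrow> let y = x + (t * sin \<phi>) *\<^sub>R dir \<theta> in sin \<phi> * (1 + y \<bullet> y) powr (- 3/2)))"
    by (auto simp: kirchhoff_def cone_pt_def wave_kernel_initial fun_eq_iff Let_def)
  finally show ?thesis
    by simp
qed

section \<open>Decay estimates\<close>

lemma japanese_real: "\<langle>a\<rangle> = sqrt (1 + a\<^sup>2)" for a :: real
  by (simp add: japanese_def)

lemma japanese_ge_1: "1 \<le> \<langle>y\<rangle>"
  by (simp add: japanese_def)

lemma japanese_nonzero [simp]: "\<langle>y\<rangle> \<noteq> 0"
  using japanese_ge_1[of y] by linarith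

text \<open>The triangle inequality in the complex plane for
  \<open>1 + ia = (1 + is) + i(a - s)\<close>.\<close>

lemma japanese_triangle: "\<langle>a\<rangle> \<le> \<langle>s\<rangle> + \<langle>a - s\<rangle>" for a s :: real
proof -
  have "\<langle>a\<rangle> \<le> norm (Complex 1 s + Complex 0 (a - s))"
    by (simp add: japanese_def cmod_def)
  also have "\<dots> \<le> norm (Complex 1 s) + norm (Complex 0 (a - s))"
    by (rule norm_triangle_ineq)
  also have "\<dots> \<le> \<langle>s\<rangle> + \<langle>a - s\<rangle>"
    by (simp add: japanese_def cmod_def real_le_rsqrt)
  finally show ?thesis .
qed

lemma powr_half_mult_le:
  fixes a b :: real
  assumes "0 < a" "0 < b"
  shows "a powr (- 1/2) * b powr (- 1/2) \<le> 1 / a + 1 / b"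
proof -
  have "a powr (- 1/2) * b powr (- 1/2) = sqrt (1 / a * (1 / b))"
    using assms by (simp add: powr_minus_divide powr_half_sqrt real_sqrt_divide real_sqrt_mult)
  also have "\<dots> \<le> (1 / a + 1 / b) / 2"
    using assms by (intro arith_geo_mean_sqrt) auto
  also have "\<dots> \<le> 1 / a + 1 / b"
    using assms by (simp add: field_simps)
  finally show ?thesis .
qed

text \<open>Here \<open>a\<close>, \<open>b\<close>, \<open>c\<close> stand for the brackets of
  \<open>s\<close>, \<open>t - |x| - s\<close> and \<open>t + |x| - s\<close>. Each maximum cancels
  against a negative power of the same variable. If \<open>a \<le> b\<close>, the surplus
  \<open>(b / a) powr \<mu>\<close> is first raised to \<open>(b / a) powr (1/2)\<close>, using
  \<open>\<mu> \<le> 1/2\<close>. What remains is a product of two powers -1/2, split by the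
  arithmetic-geometric mean inequality or already equal to \<open>1 / a\<close>.\<close>

lemma decay_weights:
  fixes a b c \<mu> :: real
  assumes "1 \<le> a" "1 \<le> b" "1 \<le> c" "0 < \<mu>" "\<mu> \<le> 1/2"
  shows "a powr (- 1/2 - \<mu>) * b powr (- 1/2) * c powr (- 1/2) * (max a c powr (1/2) * max a b powr \<mu>)
    \<le> 1 / a + 1 / b + 1 / c"
proof -
  have pos: "0 < a" "0 < b" "0 < c" using assms by auto
  have split: "a powr (- 1/2 - \<mu>) = a powr (- 1/2) * a powr (- \<mu>)"
    by (simp flip: powr_add)
  have canc: "y powr (- 1/2) * y powr (1/2) = 1" "y powr (- \<mu>) * y powr \<mu> = 1" if "y > 0" for y
    using that by (simp_all flip: powr_add)
  note half = powr_half_mult_le[OF pos(1,2)] powr_half_mult_le[OF pos(1,3)] powr_half_mult_le[OF pos(2,3)]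
  have inv: "1 / a > 0" "1 / b > 0" "1 / c > 0"
    using pos by auto
  have ratio: "a powr (- \<mu>) * b powr \<mu> \<le> a powr (- 1/2) * b powr (1/2)" if "a \<le> b"
  proof -
    have "(b / a) powr \<mu> \<le> (b / a) powr (1/2)"
      using that pos assms by (intro powr_mono) auto
    then show ?thesis
      using pos by (simp add: powr_divide powr_minus_divide)
  qed
  have aa: "a powr (- 1/2) * a powr (- 1/2) = 1 / a"
    using pos by (simp flip: powr_add add: powr_minus_divide)
  show ?thesis
  proof (cases "a \<le> c")
    case ac: True
    have "a powr (- 1/2 - \<mu>) * b powr (- 1/2) * c powr (- 1/2) * (max a c powr (1/2) * max a b powr \<mu>)
        = a powr (- 1/2) * b powr (- 1/2) * (a powr (- \<mu>) * max a b powr \<mu>) * (c powr (- 1/2) * c powr (1/2))"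
      unfolding split using ac by (simp add: max_def mult_ac)
    also have "\<dots> = a powr (- 1/2) * b powr (- 1/2) * (a powr (- \<mu>) * max a b powr \<mu>)"
      using canc pos by simp
    also have "\<dots> \<le> 1 / a + 1 / b"
    proof (cases "a \<le> b")
      case True
      have "a powr (- 1/2) * b powr (- 1/2) * (a powr (- \<mu>) * b powr \<mu>)
          \<le> a powr (- 1/2) * b powr (- 1/2) * (a powr (- 1/2) * b powr (1/2))"
        using ratio[OF True] by (intro mult_left_mono) auto
      also have "\<dots> = (a powr (- 1/2) * a powr (- 1/2)) * (b powr (- 1/2) * b powr (1/2))"
        by (simp add: mult_ac)
      also have "\<dots> = 1 / a"
        using aa canc pos by simp
      finally show ?thesis using inv unfolding max_absorb2[OF True] by linarith
    next
      case False
      then have "max a b = a" by simp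
      then show ?thesis using half(1) canc(2)[OF pos(1)] by simp
    qed
    finally show ?thesis using inv by linarith
  next
    case False
    then have ac: "c \<le> a" by simp
    have "a powr (- 1/2 - \<mu>) * b powr (- 1/2) * c powr (- 1/2) * (max a c powr (1/2) * max a b powr \<mu>)
        = b powr (- 1/2) * c powr (- 1/2) * (a powr (- \<mu>) * max a b powr \<mu>) * (a powr (- 1/2) * a powr (1/2))"
      unfolding split using ac False by (simp add: max_def mult_ac)
    also have "\<dots> = b powr (- 1/2) * c powr (- 1/2) * (a powr (- \<mu>) * max a b powr \<mu>)"
      using canc pos by simp
    also have "\<dots> \<le> 1 / a + 1 / b + 1 / c"
    proof (cases "a \<le> b")
      case True
      have "b powr (- 1/2) * c powr (- 1/2) * (a powr (- \<mu>) * b powr \<mu>)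
          \<le> b powr (- 1/2) * c powr (- 1/2) * (a powr (- 1/2) * b powr (1/2))"
        using ratio[OF True] by (intro mult_left_mono) auto
      also have "\<dots> = (a powr (- 1/2) * c powr (- 1/2)) * (b powr (- 1/2) * b powr (1/2))"
        by (simp add: mult_ac)
      also have "\<dots> = a powr (- 1/2) * c powr (- 1/2)"
        using canc(1)[OF pos(2)] by simp
      finally show ?thesis using half inv unfolding max_absorb2[OF True] by linarith
    next
      case False
      then have "max a b = a" by simp
      then have "b powr (- 1/2) * c powr (- 1/2) * (a powr (- \<mu>) * max a b powr \<mu>) = b powr (- 1/2) * c powr (- 1/2)"
        using canc(2)[OF pos(1)] by simp
      then show ?thesis using half(3) inv by linarith
    qed
    finally show ?thesis by linarith
  qed
qed

text \<open>The outer weights are moved onto the brackets inside the integral: each outer bracket is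
  at most twice the larger of its two parts. The two factors \<open>2 powr (1/2)\<close> make the
  constant 2.\<close>

lemma integrand_bound:
  fixes s A B \<mu> :: real
  assumes "0 < \<mu>" "\<mu> \<le> 1/2"
  shows "\<langle>A\<rangle> powr (1/2) * \<langle>B\<rangle> powr \<mu> * (\<langle>s\<rangle> powr (- 1/2 - \<mu>) * (\<langle>A - s\<rangle> powr (- 1/2) * \<langle>B - s\<rangle> powr (- 1/2)))
    \<le> 2 * (1 / \<langle>s\<rangle> + 1 / \<langle>B - s\<rangle> + 1 / \<langle>A - s\<rangle>)"
proof -
  let ?a = "\<langle>s\<rangle>" and ?b = "\<langle>B - s\<rangle>" and ?c = "\<langle>A - s\<rangle>"
  let ?w = "?a powr (- 1/2 - \<mu>) * ?b powr (- 1/2) * ?c powr (- 1/2)"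
  have dom: "\<langle>Y\<rangle> powr e \<le> 2 powr (1/2) * max ?a \<langle>Y - s\<rangle> powr e" if "0 < e" "e \<le> 1/2" for Y e
  proof -
    have "\<langle>Y\<rangle> \<le> 2 * max ?a \<langle>Y - s\<rangle>"
      using japanese_triangle[of Y s] by linarith
    then have "\<langle>Y\<rangle> powr e \<le> (2 * max ?a \<langle>Y - s\<rangle>) powr e"
      using that japanese_ge_1[of Y] by (intro powr_mono2) auto
    also have "\<dots> = 2 powr e * max ?a \<langle>Y - s\<rangle> powr e"
      using japanese_ge_1[of s] by (intro powr_mult)
    also have "\<dots> \<le> 2 powr (1/2) * max ?a \<langle>Y - s\<rangle> powr e"
      using that by (intro mult_right_mono powr_mono) auto
    finally show ?thesis .
  qed
  have "\<langle>A\<rangle> powr (1/2) * \<langle>B\<rangle> powr \<mu> \<le> (2 powr (1/2) * max ?a ?c powr (1/2)) * (2 powr (1/2) * max ?a ?b powr \<mu>)"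
    using assms by (intro mult_mono dom) auto
  also have "\<dots> = 2 * (max ?a ?c powr (1/2) * max ?a ?b powr \<mu>)"
    by (simp add: powr_half_sqrt)
  finally have "\<langle>A\<rangle> powr (1/2) * \<langle>B\<rangle> powr \<mu> * ?w \<le> 2 * (max ?a ?c powr (1/2) * max ?a ?b powr \<mu>) * ?w"
    by (intro mult_right_mono) auto
  also have "\<dots> = 2 * (?w * (max ?a ?c powr (1/2) * max ?a ?b powr \<mu>))"
    by (simp only: mult_ac)
  also have "\<dots> \<le> 2 * (1 / ?a + 1 / ?b + 1 / ?c)"
    using assms japanese_ge_1 by (intro mult_left_mono decay_weights) auto
  finally show ?thesis by (simp only: mult_ac)
qed

section \<open>Logarithmic growth of the time integral\<close>

lemma arsinh_le: "arsinh y \<le> 2 * ln (2 + y)" if "0 \<le> y" for y :: real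
proof -
  have "sqrt (y\<^sup>2 + 1) \<le> y + 1"
    using that by (intro real_le_lsqrt) (auto simp: power2_eq_square algebra_simps)
  moreover have "(2 + y)\<^sup>2 = 4 + 4 * y + y\<^sup>2"
    by (simp add: power2_eq_square algebra_simps)
  ultimately have "y + sqrt (y\<^sup>2 + 1) \<le> (2 + y)\<^sup>2"
    using that zero_le_power2[of y] by linarith
  then have "arsinh y \<le> ln ((2 + y)\<^sup>2)"
    unfolding arsinh_real_def using that by (intro ln_mono) (auto intro: add_nonneg_pos simp: arsinh_real_aux)
  also have "\<dots> = 2 * ln (2 + y)"
    using that by (simp add: ln_realpow)
  finally show ?thesis .
qed

lemma arsinh_mono: "arsinh a \<le> arsinh b" if "a \<le> b" for a b :: real
  using that arsinh_real_strict_mono by (cases "a = b") (auto simp: strict_mono_def intro: less_imp_le)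

lemma arsinh_deriv:
  "((\<lambda>s::real. arsinh s - arsinh (B - s) - arsinh (A - s)) has_real_derivative
     (1 / \<langle>s\<rangle> + 1 / \<langle>B - s\<rangle> + 1 / \<langle>A - s\<rangle>)) (at s)"
  by (rule derivative_eq_intros DERIV_chain2[OF arsinh_real_has_field_derivative] refl)+
    (simp add: japanese_real add.commute)

text \<open>At \<open>s = t\<close> the terms \<open>arsinh (- r)\<close> and
  \<open>arsinh r\<close> cancel by oddness, so three values remain, each at most
  \<open>2 * ln (2 + t + r)\<close>.\<close>

lemma arsinh_total:
  fixes t r :: real
  assumes "0 \<le> t" "0 \<le> r"
  shows "(arsinh t - arsinh ((t - r) - t) - arsinh ((t + r) - t))
      - (arsinh 0 - arsinh ((t - r) - 0) - arsinh ((t + r) - 0)) \<le> 6 * ln (2 + t + r)"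
proof -
  have "arsinh t \<le> arsinh (t + r)" "arsinh (t - r) \<le> arsinh (t + r)"
    using assms by (auto intro: arsinh_mono)
  moreover have "arsinh (t + r) \<le> 2 * ln (2 + t + r)"
    using arsinh_le[of "t + r"] assms by (simp add: add.assoc)
  ultimately show ?thesis by simp
qed

section \<open>Classical derivatives and the maximum principle\<close>

lemma jet2_uminus: "jet2 S u D D2 \<Longrightarrow> jet2 S (\<lambda>p. - u p) (\<lambda>p h. - D p h) (\<lambda>h p k. - D2 h p k)"
  unfolding jet2_def by (auto intro!: has_derivative_minus continuous_intros)

lemma jet2_slice:
  fixes w :: "real \<Rightarrow> real^2 \<Rightarrow> real"
  assumes jet: "jet2 spacetime (\<lambda>(t, x). w t x) D D2" and "0 \<le> t"
  shows jet2_slice_deriv: "((\<lambda>h. w t (x + h *\<^sub>R axis i 1)) has_real_derivative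
      D (t, x + h *\<^sub>R axis i 1) (0, axis i 1)) (at h)"
    and jet2_slice_deriv2: "((\<lambda>h. D (t, x + h *\<^sub>R axis i 1) k) has_real_derivative
      D2 k (t, x + h *\<^sub>R axis i 1) (0, axis i 1)) (at h)"
proof -
  have im: "range (\<lambda>h. (t, x + h *\<^sub>R axis i 1)) \<subseteq> spacetime"
    using \<open>0 \<le> t\<close> by (auto simp: spacetime_def)
  have vd: "((\<lambda>h. (t, x + h *\<^sub>R axis i 1)) has_vector_derivative (0, axis i 1)) (at h)"
    by (auto intro!: derivative_eq_intros)
  show "((\<lambda>h. w t (x + h *\<^sub>R axis i 1)) has_real_derivative
      D (t, x + h *\<^sub>R axis i 1) (0, axis i 1)) (at h)"
    and "((\<lambda>h. D (t, x + h *\<^sub>R axis i 1) k) has_real_derivative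
      D2 k (t, x + h *\<^sub>R axis i 1) (0, axis i 1)) (at h)"
    using jet2_path[OF jet im UNIV_I vd] by simp_all
qed

lemma partial_jet2:
  assumes jet: "jet2 spacetime (\<lambda>(t, x). w t x) D D2" and "0 \<le> t"
  shows "partial i (w t) x = D (t, x) (0, axis i 1)"
    and "partial i (partial i (w t)) x = D2 (0, axis i 1) (t, x) (0, axis i 1)"
proof -
  have 1: "partial i (w t) y = D (t, y) (0, axis i 1)" for y
    unfolding partial_def using jet2_slice_deriv[OF assms, of y i 0] by (simp add: DERIV_imp_deriv)
  then show "partial i (w t) x = D (t, x) (0, axis i 1)" .
  show "partial i (partial i (w t)) x = D2 (0, axis i 1) (t, x) (0, axis i 1)"
    unfolding partial_def[of i "partial i (w t)"] 1
    using jet2_slice_deriv2[OF assms, of x i "(0, axis i 1)" 0] by (simp add: DERIV_imp_deriv)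
qed

lemma laplacian_jet2:
  assumes "jet2 spacetime (\<lambda>(t, x). w t x) D D2" and "0 \<le> t"
  shows "laplacian (w t) x = D2 (0, axis 1 1) (t, x) (0, axis 1 1) + D2 (0, axis 2 1) (t, x) (0, axis 2 1)"
  by (simp add: laplacian_def partial_jet2[OF assms])

lemma time_deriv_jet2:
  assumes jet: "jet2 spacetime (\<lambda>(t, x). w t x) D D2" and "0 \<le> t"
  shows "time_deriv w t x = D (t, x) (1, 0)"
    and "time_deriv (time_deriv w) t x = D2 (1, 0) (t, x) (1, 0)"
proof -
  have im: "(\<lambda>s. (s, x)) ` {0..} \<subseteq> spacetime"
    by (auto simp: spacetime_def)
  have vd: "((\<lambda>s. (s, x)) has_vector_derivative (1, 0)) (at t within {0..})" for t
    by (auto intro!: derivative_eq_intros)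
  \<comment> \<open>Uniqueness of the vector derivative needs a nontrivial filter, also at
    \<open>t = 0\<close>; the right-hand neighbourhoods suffice.\<close>
  have nontriv: "at t within {0..} \<noteq> bot" if "t \<ge> 0" for t :: real
  proof -
    have "at_right t \<le> at t within {0..}"
      by (rule at_le) (use that in auto)
    then show ?thesis
      using trivial_limit_at_right_real[of t] by (metis bot_unique)
  qed
  have vec: "vector_derivative f (at t within {0..}) = d"
    if "(f has_vector_derivative d) (at t within {0..})" "t \<ge> 0" for f :: "real \<Rightarrow> real" and d t
    using vector_derivative_within[OF nontriv that(1)] that(2) by simp
  have 1: "time_deriv w s x = D (s, x) (1, 0)" if "s \<ge> 0" for s
    unfolding time_deriv_def
    using jet2_path(1)[OF jet im _ vd, of s] that
    by (intro vec) (auto simp: has_real_derivative_iff_has_vector_derivative)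
  then show "time_deriv w t x = D (t, x) (1, 0)"
    using \<open>0 \<le> t\<close> .
  have "((\<lambda>s. D (s, x) (1, 0)) has_vector_derivative D2 (1, 0) (t, x) (1, 0)) (at t within {0..})"
    using jet2_path(2)[OF jet im _ vd, of t] \<open>0 \<le> t\<close>
    by (auto simp: has_real_derivative_iff_has_vector_derivative)
  then have "((\<lambda>s. time_deriv w s x) has_vector_derivative D2 (1, 0) (t, x) (1, 0)) (at t within {0..})"
    by (rule has_vector_derivative_transform[rotated 2]) (use \<open>0 \<le> t\<close> 1 in auto)
  then show "time_deriv (time_deriv w) t x = D2 (1, 0) (t, x) (1, 0)"
    unfolding time_deriv_def[of "time_deriv w"] using \<open>0 \<le> t\<close> by (rule vec)
qed

text \<open>If \<open>c > 0\<close>, then \<open>f'\<close> is positive just to the right of its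
  zero at 0, and the mean value theorem produces a value above the maximum.\<close>

lemma second_derivative_nonpos_at_max:
  fixes f :: "real \<Rightarrow> real"
  assumes f: "\<And>h. (f has_real_derivative f' h) (at h)" and "(f' has_real_derivative c) (at 0)"
    and max: "\<And>h. f h \<le> f 0"
  shows "c \<le> 0"
proof (rule ccontr)
  assume "\<not> c \<le> 0"
  then obtain d where d: "d > 0" "\<And>h. 0 < h \<Longrightarrow> h < d \<Longrightarrow> f' 0 < f' (0 + h)"
    using DERIV_pos_inc_right[OF assms(2)] by auto
  have "f' 0 = 0"
    using DERIV_local_max[OF f zero_less_one] max by blast
  obtain z where "0 < z" "z < d / 2" "f (d / 2) - f 0 = (d / 2 - 0) * f' z"
    using MVT2[of 0 "d / 2" f f'] f d(1) by auto
  moreover have "f' z > 0"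
    using d \<open>f' 0 = 0\<close> calculation by (metis add_0 field_sum_of_halves less_add_same_cancel1 less_trans half_gt_zero)
  ultimately show False
    using max[of "d / 2"] d(1) by (smt (verit) half_gt_zero mult_pos_pos)
qed

text \<open>A positive value forces a positive global maximum, attained in the ball that contains
  the support. There the pure second derivatives are nonpositive, so the maximum is at most
  \<open>w - \<Delta>w \<le> B\<close>.\<close>

lemma max_principle:
  fixes w :: "real \<Rightarrow> real^2 \<Rightarrow> real"
  assumes jet: "jet2 spacetime (\<lambda>(t, x). w t x) D D2" and "0 \<le> t"
    and supp: "\<And>y. norm y > R \<Longrightarrow> w t y = 0"
    and B: "0 \<le> B" "\<And>y. w t y - (D2 (0, axis 1 1) (t, y) (0, axis 1 1) + D2 (0, axis 2 1) (t, y) (0, axis 2 1)) \<le> B"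
  shows "w t x \<le> B"
proof (cases "w t x \<le> 0")
  case False
  then have x: "x \<in> cball 0 R"
    using supp[of x] by fastforce
  have "continuous_on (cball 0 R) (\<lambda>y. case (t, y) of (t, x) \<Rightarrow> w t x)"
    by (rule continuous_on_compose2[OF jet2_cont0[OF jet]])
       (use \<open>0 \<le> t\<close> in \<open>auto intro!: continuous_intros simp: spacetime_def\<close>)
  moreover have "cball (0 :: real^2) R \<noteq> {}"
    using x by blast
  ultimately have "\<exists>z\<in>cball 0 R. \<forall>y\<in>cball 0 R. w t y \<le> w t z"
    by (intro continuous_attains_sup compact_cball) simp_all
  then obtain z where z: "\<And>y. y \<in> cball 0 R \<Longrightarrow> w t y \<le> w t z"
    by blast
  have max: "w t y \<le> w t z" for y
    using z[of y] z[OF x] supp[of y] False by (cases "norm y \<le> R") auto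
  have "D2 (0, axis i 1) (t, z) (0, axis i 1) \<le> 0" for i
    using second_derivative_nonpos_at_max[OF jet2_slice_deriv[OF jet \<open>0 \<le> t\<close>, of z i],
        of "D2 (0, axis i 1) (t, z) (0, axis i 1)"]
      jet2_slice_deriv2[OF jet \<open>0 \<le> t\<close>, of z i "(0, axis i 1)" 0] max
    by simp
  from B(2)[of z] this[of 1] this[of 2] max[of x] show ?thesis
    by linarith
qed (use B in linarith)

section \<open>Finiteness of the weighted supremum\<close>

lemma partial_eq_0_on_open:
  assumes "open U" and "\<And>y. y \<in> U \<Longrightarrow> w y = 0" and "x \<in> U"
  shows "partial i w x = 0"
proof -
  have "isCont (\<lambda>h::real. x + h *\<^sub>R axis i 1) 0"
    by (intro continuous_intros)
  then have "\<forall>\<^sub>F h in nhds 0. x + h *\<^sub>R axis i 1 \<in> U"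
    using assms(1,3) by (simp add: continuous_at_open eventually_nhds) 
  then have "\<forall>\<^sub>F h in nhds 0. w (x + h *\<^sub>R axis i 1) = 0"
    by eventually_elim (rule assms(2))
  then have "deriv (\<lambda>h. w (x + h *\<^sub>R axis i 1)) 0 = deriv (\<lambda>h. 0) (0::real)"
    by (intro deriv_cong_ev) auto
  then show ?thesis by (simp add: partial_def)
qed

lemma laplacian_eq_0_on_open:
  assumes "open U" and "\<And>y. y \<in> U \<Longrightarrow> w y = 0" and "x \<in> U"
  shows "laplacian w x = 0"
  unfolding laplacian_def
  by (simp add: partial_eq_0_on_open[OF assms(1) _ assms(3)] partial_eq_0_on_open[OF assms(1,2)])

text \<open>A real supremum dominates its terms only once boundedness is known. On the compact
  cylinder this is continuity; outside the ball both \<open>w\<close> and its Laplacian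
  vanish.\<close>

lemma weighted_source_bdd_above:
  fixes w :: "real \<Rightarrow> real^2 \<Rightarrow> real"
  assumes jet: "jet2 spacetime (\<lambda>(t, x). w t x) D D2"
    and supp: "\<And>s y. 0 \<le> s \<Longrightarrow> norm y > R \<Longrightarrow> w s y = 0"
  shows "bdd_above ((\<lambda>(s, y). \<langle>s\<rangle> powr a * \<bar>w s y - laplacian (w s) y\<bar>) ` ({0..t} \<times> UNIV))"
proof -
  let ?F = "\<lambda>(s, y). \<langle>s\<rangle> powr a * \<bar>w s y - laplacian (w s) y\<bar>"
  let ?G = "\<lambda>p. \<langle>fst p\<rangle> powr a * \<bar>(\<lambda>(t, x). w t x) p - (D2 (0, axis 1 1) p (0, axis 1 1) + D2 (0, axis 2 1) p (0, axis 2 1))\<bar>"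
  let ?K = "{0..t} \<times> cball 0 R"
  have K: "?K \<subseteq> spacetime"
    by (auto simp: spacetime_def)
  have "continuous_on ?K (\<lambda>p. \<langle>fst p\<rangle>)"
    unfolding japanese_def by (intro continuous_intros)
  then have ca: "continuous_on ?K (\<lambda>p. \<langle>fst p\<rangle> powr a)"
    by (intro continuous_on_powr continuous_on_const) simp_all
  have c0: "continuous_on ?K (\<lambda>p. (\<lambda>(t, x). w t x) p)"
    using jet2_cont0[OF jet] K by (rule continuous_on_subset)
  have c2: "continuous_on ?K (\<lambda>p. D2 h p k)" for h k
    using jet2_cont2[OF jet] K by (rule continuous_on_subset)
  have "continuous_on ?K ?G"
    by (rule continuous_on_mult[OF ca continuous_on_rabs[OF continuous_on_diff[OF c0
      continuous_on_add[OF c2[of "(0, axis 1 1)" "(0, axis 1 1)"] c2[of "(0, axis 2 1)" "(0, axis 2 1)"]]]]])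
  then have "compact (?G ` ?K)"
    by (intro compact_continuous_image compact_Times) auto
  then have "bdd_above (?G ` ?K)"
    by (intro bounded_imp_bdd_above compact_imp_bounded)
  then obtain b where b: "\<And>p. p \<in> ?K \<Longrightarrow> ?G p \<le> b"
    unfolding bdd_above_def by blast
  have "?F (s, y) \<le> max b 0" if "s \<in> {0..t}" for s y
  proof (cases "norm y \<le> R")
    case True
    then show ?thesis
      using b[of "(s, y)"] that by (simp add: laplacian_jet2[OF jet])
  next
    case False
    have "open {y :: real^2. norm y > R}"
      by (intro open_Collect_less continuous_intros)
    then have "laplacian (w s) y = 0"
      by (rule laplacian_eq_0_on_open) (use supp False that in auto)
    then show ?thesis
      using supp[of s y] False that by simp
  qed
  then show ?thesis
    by (intro bdd_aboveI[of _ "max b 0"]) auto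
qed

section \<open>The weighted estimate\<close>

lemma wave_op_solution:
  assumes jet: "jet2 spacetime (\<lambda>(t, x). v t x) D D2" and "solves_wave H v" and "0 \<le> t"
  shows "wave_op D2 (t, x) = H t x"
proof -
  have "H t x = dalembertian v t x"
    using assms by (simp add: solves_wave_def)
  also have "\<dots> = wave_op D2 (t, x)"
    by (simp add: dalembertian_def wave_op_def laplacian_jet2[OF jet \<open>0 \<le> t\<close>] time_deriv_jet2[OF jet \<open>0 \<le> t\<close>])
  finally show ?thesis by simp
qed

lemma kirchhoff_initial_eq_0:
  assumes jet: "jet2 spacetime (\<lambda>(t, x). v t x) D D2" and "solves_wave H v"
  shows "kirchhoff (\<lambda>(t, x). v t x) D t x 0 z = 0"
proof -
  have v: "v 0 y = 0" "time_deriv v 0 y = 0" for y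
    using assms by (auto simp: solves_wave_def)
  have "partial i (v 0) y = 0" for i y
    by (rule partial_eq_0_on_open[of UNIV]) (auto simp: v)
  then show ?thesis
    using v partial_jet2(1)[OF jet order_refl] time_deriv_jet2(1)[OF jet order_refl]
    by (auto simp: kirchhoff_def cone_pt_def Let_def split: prod.split)
qed

text \<open>On the support \<open>(1 + R\<^sup>2) powr (3/2) * (1 + |y|^2) powr (- 3/2)\<close> is
  at least 1, so \<open>h\<close> is dominated by a multiple of the initial velocity of the kernel,
  whose mean is already estimated.\<close>

lemma source_mean_bound:
  fixes h :: "real^2 \<Rightarrow> real"
  assumes "0 \<le> \<tau>" "0 \<le> b" "0 \<le> R" "continuous_on UNIV h"
    and h: "\<And>y. \<bar>h y\<bar> \<le> b" "\<And>y. norm y > R \<Longrightarrow> h y = 0"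
  shows "\<bar>\<tau> * integral hemi (\<lambda>(\<phi>, \<theta>). sin \<phi> * h (x + (\<tau> * sin \<phi>) *\<^sub>R dir \<theta>))\<bar>
    \<le> b * (1 + R\<^sup>2) powr (3/2) * (2 * pi * (\<langle>\<tau> + norm x\<rangle> powr (- 1/2) * \<langle>\<tau> - norm x\<rangle> powr (- 1/2)))"
proof -
  let ?y = "\<lambda>z. x + (\<tau> * sin (fst z)) *\<^sub>R dir (snd z)"
  let ?\<kappa> = "(1 + R\<^sup>2) powr (3/2)"
  let ?f = "\<lambda>z. sin (fst z) * h (?y z)"
  let ?g = "\<lambda>z. sin (fst z) * (1 + ?y z \<bullet> ?y z) powr (- 3/2)"
  have pt: "\<bar>h y\<bar> \<le> b * ?\<kappa> * (1 + y \<bullet> y) powr (- 3/2)" for y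
  proof (cases "norm y \<le> R")
    case True
    have "y \<bullet> y \<le> R\<^sup>2"
      using True by (simp add: power_mono flip: power2_norm_eq_inner)
    then have "(1 + R\<^sup>2) powr (- 3/2) \<le> (1 + y \<bullet> y) powr (- 3/2)"
      by (intro powr_mono2') (auto intro: add_pos_nonneg)
    then have "?\<kappa> * (1 + R\<^sup>2) powr (- 3/2) \<le> ?\<kappa> * (1 + y \<bullet> y) powr (- 3/2)"
      by (intro mult_left_mono) auto
    moreover have "?\<kappa> * (1 + R\<^sup>2) powr (- 3/2) = 1"
    proof -
      have "1 + R\<^sup>2 \<noteq> 0" by (smt (verit) zero_le_power2)
      then show ?thesis by (simp flip: powr_add)
    qed
    ultimately have "b * 1 \<le> b * (?\<kappa> * (1 + y \<bullet> y) powr (- 3/2))"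
      using \<open>0 \<le> b\<close> by (intro mult_left_mono) auto
    then show ?thesis
      using h(1)[of y] by (simp add: mult.assoc)
  next
    case False
    then show ?thesis using h(2)[of y] \<open>0 \<le> b\<close> by simp
  qed
  have cy: "continuous_on hemi ?y"
    unfolding dir_def by (intro continuous_intros)
  have nz: "1 + y \<bullet> y \<noteq> 0" for y :: "real^2"
    by (smt (verit) inner_ge_zero)
  have cf: "continuous_on hemi ?f"
    by (intro continuous_intros continuous_on_compose2[OF assms(4) cy]) auto
  have cg: "continuous_on hemi ?g"
    by (intro continuous_intros cy) (simp add: nz)
  have sin: "0 \<le> sin (fst z)" if "z \<in> hemi" for z
    using that by (intro sin_ge_zero) (auto simp: cbox_Pair_eq)
  have "norm (integral hemi ?f) \<le> integral hemi (\<lambda>z. b * ?\<kappa> * ?g z)"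
  proof (rule integral_norm_bound_integral)
    show "norm (?f z) \<le> b * ?\<kappa> * ?g z" if "z \<in> hemi" for z
      using mult_left_mono[OF pt[of "?y z"] sin[OF that]] sin[OF that] by (simp add: abs_mult mult_ac)
  qed (rule integrable_continuous[OF cf], rule integrable_continuous[OF continuous_on_mult[OF continuous_on_const cg]])
  also have "\<dots> = b * ?\<kappa> * integral hemi ?g"
    by simp
  finally have "\<tau> * norm (integral hemi ?f) \<le> \<tau> * (b * ?\<kappa> * integral hemi ?g)"
    using assms(1) by (rule mult_left_mono)
  also have "\<dots> = b * ?\<kappa> * (\<tau> * integral hemi ?g)"
    by simp
  also have "\<dots> \<le> b * ?\<kappa> * (2 * pi * (\<langle>\<tau> + norm x\<rangle> powr (- 1/2) * \<langle>\<tau> - norm x\<rangle> powr (- 1/2)))"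
    using wave_kernel_mean_bound[OF \<open>0 \<le> \<tau>\<close>, of x] \<open>0 \<le> b\<close>
    by (intro mult_left_mono) (auto simp: Let_def case_prod_unfold)
  finally show ?thesis
    using assms(1) by (simp add: abs_mult case_prod_unfold)
qed

theorem lemma3p8:
  fixes R \<mu> :: real
  assumes "R > 1" and "0 < \<mu>" and "\<mu> \<le> 1/2"
  shows "\<exists>C>0. \<forall>(H :: real \<Rightarrow> real^2 \<Rightarrow> real) (v :: real \<Rightarrow> real^2 \<Rightarrow> real).
           Ck_on 2 spacetime (\<lambda>(t, x). H t x) \<longrightarrow>
           (\<forall>t\<ge>0. closure {x. H t x \<noteq> 0} \<subseteq> {x. norm x \<le> R}) \<longrightarrow>
           solves_wave H v \<longrightarrow>
           (\<forall>t\<ge>0. \<forall>x.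
              \<langle>t + norm x\<rangle> powr (1/2) * \<langle>t - norm x\<rangle> powr \<mu> * \<bar>v t x\<bar>
                \<le> C * (ln (2 + t + norm x))\<^sup>2 *
                  (SUP (s, y) \<in> {0..t} \<times> UNIV.
                     \<langle>s\<rangle> powr (1/2 + \<mu>) * \<bar>H s y - laplacian (H s) y\<bar>))"
proof -
  define \<kappa> where "\<kappa> = (1 + R\<^sup>2) powr (3/2)"
  have "\<kappa> > 0"
    unfolding \<kappa>_def using assms(1) by (smt (verit) powr_gt_zero zero_le_power2)
  have "ln (2::real) > 0" by simp
  show ?thesis
  \<comment> \<open>The derivative bound has constant \<open>4 * pi\<close> and the arsinh
    difference 6; dividing by the hemisphere area \<open>2 * pi\<close> gives 12. The factor
    \<open>1 / ln 2\<close> pays for squaring the logarithm.\<close>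
  proof (intro exI[of _ "12 * \<kappa> / ln 2"] conjI allI impI)
    show "0 < 12 * \<kappa> / ln 2"
      using \<open>\<kappa> > 0\<close> by simp
  next
    fix H v :: "real \<Rightarrow> real^2 \<Rightarrow> real" and t :: real and x :: "real^2"
    assume H: "Ck_on 2 spacetime (\<lambda>(t, x). H t x)"
      and supp: "\<forall>t\<ge>0. closure {x. H t x \<noteq> 0} \<subseteq> {x. norm x \<le> R}"
      and sol: "solves_wave H v" and "0 \<le> t"
    obtain DH DH2 where jetH: "jet2 spacetime (\<lambda>(t, x). H t x) DH DH2"
      using H by (rule Ck_on_2_imp_jet2)
    obtain D D2 where jet: "jet2 spacetime (\<lambda>(t, x). v t x) D D2"
      using sol Ck_on_2_imp_jet2 unfolding solves_wave_def by blast
    have H0: "H s y = 0" if "0 \<le> s" "norm y > R" for s y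
      using supp that closure_subset[of "{x. H s x \<noteq> 0}"] by fastforce
    define M where "M = (SUP (s, y) \<in> {0..t} \<times> UNIV. \<langle>s\<rangle> powr (1/2 + \<mu>) * \<bar>H s y - laplacian (H s) y\<bar>)"
    have M: "\<langle>s\<rangle> powr (1/2 + \<mu>) * \<bar>H s y - laplacian (H s) y\<bar> \<le> M" if "s \<in> {0..t}" for s y
      using cSUP_upper[OF _ weighted_source_bdd_above[OF jetH H0, where t=t and a="1/2 + \<mu>"], of "(s, y)"] that
      unfolding M_def by auto
    have "0 \<le> M"
      using M[of 0 0] \<open>0 \<le> t\<close> by (smt (verit) atLeastAtMost_iff mult_nonneg_nonneg powr_ge_zero)
    define b where "b s = M * \<langle>s\<rangle> powr (- 1/2 - \<mu>)" for s :: real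
    have b: "0 \<le> b s" for s :: real
      using \<open>0 \<le> M\<close> by (simp add: b_def)
    have src: "\<bar>H s y - laplacian (H s) y\<bar> \<le> b s" if "s \<in> {0..t}" for s y
    proof -
      have "\<langle>s\<rangle> powr (- 1/2 - \<mu>) * \<langle>s\<rangle> powr (1/2 + \<mu>) = 1"
        by (simp flip: powr_add)
      then have "\<bar>H s y - laplacian (H s) y\<bar>
          = \<langle>s\<rangle> powr (- 1/2 - \<mu>) * (\<langle>s\<rangle> powr (1/2 + \<mu>) * \<bar>H s y - laplacian (H s) y\<bar>)"
        by (simp only: mult.assoc[symmetric] mult_1)
      also have "\<dots> \<le> \<langle>s\<rangle> powr (- 1/2 - \<mu>) * M"
        by (rule mult_left_mono[OF M[OF that]]) simp
      finally show ?thesis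
        by (simp only: b_def mult.commute[of M])
    qed
    \<comment> \<open>The maximum principle for \<open>H\<close> and for \<open>- H\<close>
      transfers the bound from \<open>(1 - \<Delta>)H\<close> to \<open>H\<close>.\<close>
    have Hb: "\<bar>H s y\<bar> \<le> b s" if s: "s \<in> {0..t}" for s y
    proof -
      have "0 \<le> s" using s by simp
      note lap = laplacian_jet2[OF jetH \<open>0 \<le> s\<close>]
      have "H s y \<le> b s"
        by (rule max_principle[OF jetH \<open>0 \<le> s\<close> H0[OF \<open>0 \<le> s\<close>] b])
           (use src[OF s] in \<open>auto simp: abs_le_iff simp flip: lap\<close>)
      moreover have "- H s y \<le> b s"
      proof (rule max_principle[of "\<lambda>t x. - H t x"])
        show "jet2 spacetime (\<lambda>(t, x). - H t x) (\<lambda>p h. - DH p h) (\<lambda>h p k. - DH2 h p k)"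
          using jet2_uminus[OF jetH] by (simp add: case_prod_unfold)
        show "- H s z - (- DH2 (0, axis 1 1) (s, z) (0, axis 1 1) + - DH2 (0, axis 2 1) (s, z) (0, axis 2 1)) \<le> b s" for z
          using src[OF s, of z] by (simp add: lap)
      qed (use H0 b \<open>0 \<le> s\<close> in auto)
      ultimately show ?thesis by linarith
    qed
    define g where "g s = integral hemi (kirchhoff (\<lambda>(t, x). v t x) D t x s)" for s
    \<comment> \<open>By the wave equation this is the \<open>s\<close>-derivative of
      \<open>g\<close>, and \<open>g\<close> runs from 0 at \<open>s = 0\<close> to
      \<open>2 * pi * v t x\<close> at \<open>s = t\<close>.\<close>
    define g' where "g' s = (t - s) * integral hemi (\<lambda>(\<phi>, \<theta>). sin \<phi> * H s (x + ((t - s) * sin \<phi>) *\<^sub>R dir \<theta>))" for s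
    have dg: "(g has_real_derivative g' s) (at s within {0..t})" if "s \<in> {0..t}" for s
      using kirchhoff_has_derivative[OF jet \<open>0 \<le> t\<close> that, of x] that
      by (simp add: g_def[abs_def] g'_def cone_pt_def wave_op_solution[OF jet sol])
    have "g t = 2 * pi * v t x"
      unfolding g_def using kirchhoff_at_tip[OF jet \<open>0 \<le> t\<close>, of x] by simp
    have "g 0 = 0"
      unfolding g_def by (simp add: kirchhoff_initial_eq_0[OF jet sol, abs_def])
    define W where "W = \<langle>t + norm x\<rangle> powr (1/2) * \<langle>t - norm x\<rangle> powr \<mu>"
    have "0 \<le> W" by (simp add: W_def)
    \<comment> \<open>An antiderivative of the bound \<open>K'\<close> supplied by
      \<open>integrand_bound\<close>.\<close>
    define K where "K s = arsinh s - arsinh ((t - norm x) - s) - arsinh ((t + norm x) - s)" for s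
    define K' where "K' s = 1 / \<langle>s\<rangle> + 1 / \<langle>(t - norm x) - s\<rangle> + 1 / \<langle>(t + norm x) - s\<rangle>" for s
    have bound: "W * \<bar>g' s\<bar> \<le> 4 * pi * M * \<kappa> * K' s" if "s \<in> {0..t}" for s
    proof -
      have "continuous_on UNIV (\<lambda>y. case (s, y) of (t, x) \<Rightarrow> H t x)"
        by (rule continuous_on_compose2[OF jet2_cont0[OF jetH]])
           (use that in \<open>auto intro!: continuous_intros simp: spacetime_def\<close>)
      then have "continuous_on UNIV (H s)"
        by simp
      then have "\<bar>g' s\<bar> \<le> b s * \<kappa> * (2 * pi * (\<langle>t - s + norm x\<rangle> powr (- 1/2) * \<langle>t - s - norm x\<rangle> powr (- 1/2)))"
        unfolding g'_def \<kappa>_def using that assms(1) by (intro source_mean_bound b Hb H0) auto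
      then have "W * \<bar>g' s\<bar> \<le> W * \<dots>"
        using \<open>0 \<le> W\<close> by (rule mult_left_mono)
      also have "\<dots> = (2 * pi * M * \<kappa>) * (W * (\<langle>s\<rangle> powr (- 1/2 - \<mu>) *
          (\<langle>(t + norm x) - s\<rangle> powr (- 1/2) * \<langle>(t - norm x) - s\<rangle> powr (- 1/2))))"
        by (simp add: b_def algebra_simps)
      also have "\<dots> \<le> (2 * pi * M * \<kappa>) * (2 * K' s)"
        unfolding W_def K'_def using assms \<open>0 \<le> M\<close> \<open>\<kappa> > 0\<close>
        by (intro mult_left_mono integrand_bound) auto
      finally show ?thesis by simp
    qed
    have "W * \<bar>g t\<bar> \<le> 4 * pi * M * \<kappa> * (6 * ln (2 + t + norm x))"
    proof (cases "t = 0")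
      case True
      then show ?thesis
        using \<open>g 0 = 0\<close> \<open>0 \<le> M\<close> \<open>\<kappa> > 0\<close> by simp
    next
      case False
      have K: "(K has_real_derivative K' s) (at s within S)" for s S
        unfolding K_def[abs_def] K'_def by (rule has_field_derivative_at_within[OF arsinh_deriv])
      \<comment> \<open>Comparing derivatives on the open interval replaces integration of
        \<open>g'\<close>. This needs \<open>0 < t\<close>, hence the case split.\<close>
      have "norm (W * g t - W * g 0) \<le> 4 * pi * M * \<kappa> * K t - 4 * pi * M * \<kappa> * K 0"
      proof (rule differentiable_bound_general)
        show "0 < t" using False \<open>0 \<le> t\<close> by simp
        show "continuous_on {0..t} (\<lambda>s. W * g s)"
          by (intro continuous_intros DERIV_continuous_on[of _ _ g']) (rule dg)
        show "continuous_on {0..t} (\<lambda>s. 4 * pi * M * \<kappa> * K s)"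
          by (intro continuous_intros DERIV_continuous_on[of _ _ K']) (rule K)
        fix s assume s: "0 < s" "s < t"
        have "(g has_real_derivative g' s) (at s)"
          using dg[of s] s by (simp add: at_within_Icc_at)
        then show "((\<lambda>s. W * g s) has_vector_derivative W * g' s) (at s)"
          by (intro has_vector_derivative_mult_right) (simp add: has_real_derivative_iff_has_vector_derivative)
        show "((\<lambda>s. 4 * pi * M * \<kappa> * K s) has_vector_derivative 4 * pi * M * \<kappa> * K' s) (at s)"
          using K by (intro has_vector_derivative_mult_right) (simp add: has_real_derivative_iff_has_vector_derivative)
        show "norm (W * g' s) \<le> 4 * pi * M * \<kappa> * K' s"
          using bound[of s] s \<open>0 \<le> W\<close> by (simp add: abs_mult)
      qed
      also have "\<dots> = 4 * pi * M * \<kappa> * (K t - K 0)"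
        by (simp only: right_diff_distrib)
      also have "\<dots> \<le> 4 * pi * M * \<kappa> * (6 * ln (2 + t + norm x))"
        unfolding K_def using \<open>0 \<le> M\<close> \<open>\<kappa> > 0\<close> \<open>0 \<le> t\<close>
        by (intro mult_left_mono arsinh_total) auto
      finally show ?thesis
        using \<open>g 0 = 0\<close> \<open>0 \<le> W\<close> by (simp add: abs_mult)
    qed
    then have "2 * pi * (W * \<bar>v t x\<bar>) \<le> 2 * pi * (12 * \<kappa> * M * ln (2 + t + norm x))"
      using \<open>g t = 2 * pi * v t x\<close> by (simp add: abs_mult mult_ac)
    then have "W * \<bar>v t x\<bar> \<le> 12 * \<kappa> * M * ln (2 + t + norm x)"
      by (simp add: mult_ac)
    \<comment> \<open>The logarithm is at least \<open>ln 2\<close>, so it is bounded by its square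
      divided by \<open>ln 2\<close>.\<close>
    also have "\<dots> \<le> 12 * \<kappa> * M * ((ln (2 + t + norm x))\<^sup>2 / ln 2)"
    proof (intro mult_left_mono)
      have ln: "ln 2 \<le> ln (2 + t + norm x)"
        using \<open>0 \<le> t\<close> by (intro ln_mono) auto
      then have "ln (2 + t + norm x) * ln 2 \<le> ln (2 + t + norm x) * ln (2 + t + norm x)"
        using \<open>ln 2 > 0\<close> order.trans[OF _ ln, of 0] by (intro mult_left_mono) auto
      then show "ln (2 + t + norm x) \<le> (ln (2 + t + norm x))\<^sup>2 / ln 2"
        by (simp add: pos_le_divide_eq power2_eq_square)
    qed (use \<open>0 \<le> M\<close> \<open>\<kappa> > 0\<close> in auto)
    finally show "\<langle>t + norm x\<rangle> powr (1/2) * \<langle>t - norm x\<rangle> powr \<mu> * \<bar>v t x\<bar>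
      \<le> 12 * \<kappa> / ln 2 * (ln (2 + t + norm x))\<^sup>2 *
        (SUP (s, y) \<in> {0..t} \<times> UNIV. \<langle>s\<rangle> powr (1/2 + \<mu>) * \<bar>H s y - laplacian (H s) y\<bar>)"
      unfolding W_def M_def[symmetric] by (simp add: mult_ac)
  qed
qed

end
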